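(* Let $L,\varsigma,\sigma,\bar\sigma,\varsigma_H,L_H\ge 0$ and $\rho\in(0,1]$. Consider the DSGD iterates described in the context and assume: (i) for all $i\in\{1,\dots,n\}$ and all $\theta,\theta'\in\mathbb{R}^d$: $\|\nabla f_i(\theta')-\nabla f_i(\theta)\|\le L\|\theta'-\theta\|$ and $\|\nabla f(\theta)-\nabla f_i(\theta)\|\le\varsigma$; (ii) $W$ is doubly stochastic, i.e. $W\mathbf 1=W^\top\mathbf 1=\mathbf 1$, and there is a projection matrix $U$ with $I-\frac1n\mathbf 1\mathbf 1^\top=UU^\top$ and $\|U^\top WU\|\le 1-\rho$; (iii) for all $i$ and all fixed $\theta\in\mathbb{R}^d$: $\mathbb{E}_{Z_i\sim\mathsf B_i}[\nabla\ell_i(\theta;Z_i)]=\nabla f_i(\theta)$, $\mathbb{E}_{Z_i\sim\mathsf B_i}\big[\|\nabla\ell_i(\theta;Z_i)-\nabla f_i(\theta)\|^2\big]\le\sigma^2$ and $\mathbb{E}_{Z_i\sim\mathsf B_i}\big[\|\nabla\ell_i(\theta;Z_i)-\nabla f_i(\theta)\|^4\big]\le\bar\sigma^4$; (iv) for all $i$ and all $\theta\in\mathbb{R}^d$: $\|\nabla^2 f(\theta)-\nabla^2 f_i(\theta)\|\le\varsigma_H$; (v) for all $i$ and all $\theta,\theta'\in\mathbb{R}^d$: $\|\nabla^2 f_i(\theta')-\nabla^2 f_i(\theta)\|\le L_H\|\theta'-\theta\|$. Let $\mathsf D:=f(\bar\theta^0)-f^\star$, set the (constant) step size $\gamma_{t+1}=\frac{1}{\sqrt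 T}\sqrt{\frac{2\mathsf Dn}{L\sigma^2}}$, and let $\mathsf T$ be chosen uniformly at random from $\{0,\dots,T-1\}$. Then for all sufficiently large $T\ge1$, $$\mathbb{E}\Big[\|\nabla f(\bar\theta^{\mathsf T})\|^2\Big]\le\sqrt{\frac{32\mathsf DL\sigma^2}{nT}}+\frac{432L_H^2(\bar\sigma^4+4\varsigma^4)}{\rho^4T^2}\cdot\frac{(2\mathsf Dn)^2}{(L\sigma^2)^2}+\frac{64\varsigma_H^2(\sigma^2+\varsigma^2)}{\rho^2T}\cdot\frac{2\mathsf Dn}{L\sigma^2}.$$
   Context: Setting. $G=(V,E)$ is a connected undirected graph with self loops on $V=\{1,\dots,n\}$. For each agent $i\in V$, $\mathsf B_i$ is a probability distribution, $\ell_i(\theta;z)$ is a loss with gradient $\nabla\ell_i(\theta;z)$ in $\theta\in\mathbb{R}^d$, and $f_i(\theta)=\mathbb{E}_{Z_i\sim\mathsf B_i}[\ell_i(\theta;Z_i)]$ is twice continuously differentiable. Put $f=\frac1n\sum_{i=1}^nf_i$ and $f^\star=\min_{\theta\in\mathbb{R}^d}f(\theta)>-\infty$. $W\in\mathbb{R}_+^{n\times n}$ is a weighted adjacency matrix with $W_{ij}=0$ iff $(i,j)\notin E$. DSGD algorithm. Given an initialization $\{\theta_i^0\}_{i=1}^n\subset\mathbb{R}^d$ (deterministic) and positive step sizes $(\gamma_t)_{t\ge1}$, for $t=0,1,2,\dots$ and $i=1,\dots,n$, $$\theta_i^{t+1}=\sum_{j=1}^nW_{ij}\theta_j^t-\gamma_{t+1}\nabla\ell_i(\theta_i^t;Z_i^{t+1}),$$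 where $Z_i^{t+1}\sim\mathsf B_i$ are drawn independently over $i$ and $t$. The random index $\mathsf T$ is independent of the algorithm. Notation. $\bar\theta^t=\frac1n\sum_{i=1}^n\theta_i^t$. $\|\cdot\|$ is the Euclidean norm of vectors or the spectral norm of matrices, $\mathbf 1\in\mathbb{R}^n$ the all-one vector, and $\mathbb{E}[\cdot]$ the total expectation. *)

theory Defs
  imports "HOL-Probability.Probability"
begin

definition gradient :: "('a::real_inner \<Rightarrow> real) \<Rightarrow> 'a \<Rightarrow> 'a" where
  "gradient f x = (THE D. GDERIV f x :> D)"

definition hessian :: "(real^'d \<Rightarrow> real) \<Rightarrow> real^'d \<Rightarrow> real^'d^'d" where
  "hessian f x = jacobian (gradient f) (at x)"

definition twice_continuously_differentiable :: "(real^'d \<Rightarrow> real) \<Rightarrow> bool" where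
  "twice_continuously_differentiable f \<longleftrightarrow>
     (\<forall>x. f differentiable (at x)) \<and>
     (\<forall>x. gradient f differentiable (at x)) \<and>
     continuous_on UNIV (hessian f)"

text \<open>The norm inherited from \<open>real^'m^'n\<close> is the Frobenius norm, so the spectral norm
  is introduced separately, as the operator norm for the Euclidean norms.\<close>

definition spectral_norm :: "real^'m^'n \<Rightarrow> real" where
  "spectral_norm A = onorm (\<lambda>x. A *v x)"

definition avg :: "('n::finite \<Rightarrow> 'a::real_vector) \<Rightarrow> 'a" where
  "avg x = (1 / real CARD('n)) *\<^sub>R (\<Sum>i\<in>UNIV. x i)"

definition weighted_adjacency :: "('n \<times> 'n) set \<Rightarrow> real^'n^'n \<Rightarrow> bool" where
  "weighted_adjacency E W \<longleftrightarrow>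
     (\<forall>i j. 0 \<le> W $ i $ j) \<and> (\<forall>i j. W $ i $ j = 0 \<longleftrightarrow> (i, j) \<notin> E)"

definition doubly_stochastic :: "real^'n^'n \<Rightarrow> bool" where
  "doubly_stochastic W \<longleftrightarrow> W *v 1 = 1 \<and> transpose W *v 1 = 1"

text \<open>One sample path of decentralized SGD: \<open>z t i\<close> is the sample drawn by agent \<open>i\<close> to
  compute the iterate with index \<open>t\<close>, so \<open>z\<close> and \<open>\<gamma>\<close> are only used at indices \<open>t \<ge> 1\<close>.\<close>

fun dsgd :: "real^'n^'n \<Rightarrow> (nat \<Rightarrow> real) \<Rightarrow> ('n \<Rightarrow> 'a::real_inner \<Rightarrow> 'z \<Rightarrow> real) \<Rightarrow>
    ('n \<Rightarrow> 'a) \<Rightarrow> (nat \<Rightarrow> 'n \<Rightarrow> 'z) \<Rightarrow> nat \<Rightarrow> 'n \<Rightarrow> 'a" where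
  "dsgd W \<gamma> loss \<theta>0 z 0 i = \<theta>0 i"
| "dsgd W \<gamma> loss \<theta>0 z (Suc t) i =
     (\<Sum>j\<in>UNIV. W $ i $ j *\<^sub>R dsgd W \<gamma> loss \<theta>0 z t j)
     - \<gamma> (Suc t) *\<^sub>R gradient (\<lambda>\<theta>. loss i \<theta> (z (Suc t) i)) (dsgd W \<gamma> loss \<theta>0 z t i)"

definition independent_samples ::
  "'w measure \<Rightarrow> ('n \<Rightarrow> 'z measure) \<Rightarrow> (nat \<Rightarrow> 'n \<Rightarrow> 'w \<Rightarrow> 'z) \<Rightarrow> bool" where
  "independent_samples M B Z \<longleftrightarrow>
     (\<forall>t\<ge>1. \<forall>i. Z t i \<in> measurable M (B i) \<and> distr M (B i) (Z t i) = B i) \<and>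
     prob_space.indep_vars M (\<lambda>(t, i). B i) (\<lambda>(t, i). Z t i) ({1..} \<times> UNIV)"

text \<open>The initialization being deterministic, the sigma-algebra generated by the samples
  carries all the randomness of the algorithm, for every choice of the step sizes.\<close>

definition sample_events ::
  "'w measure \<Rightarrow> ('n \<Rightarrow> 'z measure) \<Rightarrow> (nat \<Rightarrow> 'n \<Rightarrow> 'w \<Rightarrow> 'z) \<Rightarrow> 'w set set" where
  "sample_events M B Z =
     sigma_sets (space M) {Z t i -` A \<inter> space M | t i A. 1 \<le> t \<and> A \<in> sets (B i)}"

definition uniform_random_index ::
  "'w measure \<Rightarrow> 'w set set \<Rightarrow> nat \<Rightarrow> ('w \<Rightarrow> nat) \<Rightarrow> bool" where
  "uniform_random_index M S T \<tau> \<longleftrightarrow>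
     \<tau> \<in> measurable M (count_space UNIV) \<and>
     distr M (count_space UNIV) \<tau> = measure_pmf (pmf_of_set {0..<T}) \<and>
     prob_space.indep_set M {\<tau> -` A \<inter> space M | A. A \<subseteq> UNIV} S"

end

theory Submission
  imports Defs
begin

text \<open>The descent lemma at the averaged iterate, summed over time, bounds
  \<open>\<gamma> \<Sum>t<T. E \<parallel>\<nabla>f\<parallel>\<^sup>2\<close> by \<open>2D + T L \<gamma>\<^sup>2 \<sigma>\<^sup>2 / n\<close> plus \<open>\<gamma> L\<^sup>2 / n\<close> times the summed consensus
  error; the noise enters with \<open>\<sigma>\<^sup>2 / n\<close> because different agents have orthogonal noise. The
  consensus error contracts with rate \<open>1 - \<rho> / 2\<close> up to \<open>O(\<gamma>\<^sup>2)\<close>, so its sum stays bounded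
  because \<open>T \<gamma>\<^sup>2\<close> is constant, and its contribution to the time average is \<open>O(1 / T)\<close>. The first
  two terms make up half of \<open>sqrt (32 D L \<sigma>\<^sup>2 / (n T))\<close>, and for large \<open>T\<close> the other half absorbs
  the consensus error; the remaining two terms of the bound are nonnegative. If \<open>D = 0\<close>, the step
  size vanishes and the average stays at a minimizer.\<close>

section \<open>Gradients\<close>

text \<open>The losses are differentiable in the parameter and, for each fixed parameter, measurable
  in the sample. Joint measurability of the sampled gradient, on which every expectation of an
  iterate rests, has to be constructed from this. Orthogonality of the noise is obtained without
  conditional expectations: the joint law of one sample and all the others is a product measure, and
  integrating over the single sample first gives zero. The step size c minimizes 2 D / (c T) + L c
  \<sigma>^2 / n. At the minimizer both terms equal 2 D / q with q = c T = sqrt (2 D n T / (L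
  \<sigma>^2)), and the leading term of the claim is exactly 8 D / q, so 4 D / q is left over. Any
  bound on the summed consensus error that does not grow with T is then good enough: its constants
  can be crude, and the threshold on T may depend on the initial disagreement of the agents.\<close>

lemma gderiv_gradient:
  fixes f :: "'a::euclidean_space \<Rightarrow> real"
  assumes "f differentiable (at x)"
  shows "GDERIV f x :> gradient f x"
proof -
  obtain f' where f': "(f has_derivative f') (at x)" using assms by (auto simp: differentiable_def)
  then interpret bounded_linear f' by (rule has_derivative_bounded_linear)
  \<comment> \<open>Riesz representation in coordinates: the representing vector has the coordinates
    \<open>f' b\<close>. Uniqueness of the derivative then justifies the definite description in
    \<open>gradient\<close>.\<close>
  have eq: "f' = (\<lambda>h. h \<bullet> (\<Sum>b\<in>Basis. f' b *\<^sub>R b))"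
  proof
    fix h
    have "f' h = f' (\<Sum>b\<in>Basis. (h \<bullet> b) *\<^sub>R b)" by (simp add: euclidean_representation)
    also have "\<dots> = h \<bullet> (\<Sum>b\<in>Basis. f' b *\<^sub>R b)"
      by (simp add: sum scaleR inner_sum_right mult.commute)
    finally show "f' h = h \<bullet> (\<Sum>b\<in>Basis. f' b *\<^sub>R b)" .
  qed
  have D: "GDERIV f x :> (\<Sum>b\<in>Basis. f' b *\<^sub>R b)"
    using f' unfolding gderiv_def by (simp flip: eq)
  show ?thesis unfolding gradient_def
  proof (rule theI)
    show "GDERIV f x :> (\<Sum>b\<in>Basis. f' b *\<^sub>R b)" by (rule D)
  next
    fix D' assume "GDERIV f x :> D'"
    then have "(\<lambda>h. h \<bullet> D') = (\<lambda>h. h \<bullet> (\<Sum>b\<in>Basis. f' b *\<^sub>R b))"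
      using D has_derivative_unique unfolding gderiv_def by blast
    then show "D' = (\<Sum>b\<in>Basis. f' b *\<^sub>R b)"
      by (metis vector_eq_ldot)
  qed
qed

lemma gradient_eqI:
  fixes f :: "'a::euclidean_space \<Rightarrow> real"
  assumes "GDERIV f x :> D"
  shows "gradient f x = D"
proof -
  have "f differentiable (at x)" using assms by (auto simp: gderiv_def differentiable_def)
  from gderiv_gradient[OF this] assms show ?thesis
    unfolding gderiv_def using has_derivative_unique by (metis (no_types, lifting) vector_eq_ldot)
qed

lemma gderiv_along_line:
  fixes f :: "'a::euclidean_space \<Rightarrow> real"
  assumes "f differentiable (at (x + s *\<^sub>R d))"
  shows "((\<lambda>s. f (x + s *\<^sub>R d)) has_real_derivative d \<bullet> gradient f (x + s *\<^sub>R d)) (at s)"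
proof -
  have "(f has_derivative (\<lambda>h. h \<bullet> gradient f (x + s *\<^sub>R d))) (at (x + s *\<^sub>R d))"
    using gderiv_gradient[OF assms] by (simp add: gderiv_def)
  moreover have "((\<lambda>s. x + s *\<^sub>R d) has_derivative (\<lambda>h. h *\<^sub>R d)) (at s)"
    by (auto intro!: derivative_eq_intros)
  ultimately have "((\<lambda>s. f (x + s *\<^sub>R d)) has_derivative (\<lambda>h. (h *\<^sub>R d) \<bullet> gradient f (x + s *\<^sub>R d))) (at s)"
    by (rule has_derivative_compose[rotated])
  then show ?thesis
    by (simp add: has_field_derivative_def mult_commute_abs)
qed

text \<open>Comparison along the segment: f minus its quadratic upper model has nonpositive
  derivative in the segment parameter, by Cauchy-Schwarz and the Lipschitz bound, so the gradient
  never has to be integrated.\<close>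

lemma descent_lemma:
  fixes f :: "'a::euclidean_space \<Rightarrow> real"
  assumes diff: "\<And>x. f differentiable (at x)"
    and smooth: "\<And>x y. norm (gradient f y - gradient f x) \<le> L * norm (y - x)"
  shows "f (x + d) \<le> f x + d \<bullet> gradient f x + L / 2 * (norm d)\<^sup>2"
proof -
  define \<phi> where "\<phi> s = f (x + s *\<^sub>R d) - s * (d \<bullet> gradient f x) - L / 2 * s\<^sup>2 * (norm d)\<^sup>2" for s
  have "\<phi> 1 \<le> \<phi> 0"
  proof (rule DERIV_nonpos_imp_nonincreasing[of 0 1])
    fix s :: real assume s: "0 \<le> s" "s \<le> 1"
    have "d \<bullet> (gradient f (x + s *\<^sub>R d) - gradient f x) \<le> norm d * (L * (s * norm d))"
      using norm_cauchy_schwarz[of d "gradient f (x + s *\<^sub>R d) - gradient f x"]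
        mult_left_mono[OF smooth[of "x + s *\<^sub>R d" x] norm_ge_zero[of d]] s by simp
    then have "d \<bullet> gradient f (x + s *\<^sub>R d) - d \<bullet> gradient f x - L * s * (norm d)\<^sup>2 \<le> 0"
      by (simp add: inner_diff_right power2_eq_square mult_ac)
    moreover have "(\<phi> has_real_derivative
        d \<bullet> gradient f (x + s *\<^sub>R d) - d \<bullet> gradient f x - L * s * (norm d)\<^sup>2) (at s)"
      unfolding \<phi>_def by (auto intro!: derivative_eq_intros gderiv_along_line diff)
    ultimately show "\<exists>y. (\<phi> has_real_derivative y) (at s) \<and> y \<le> 0" by blast
  qed simp
  then show ?thesis by (simp add: \<phi>_def)
qed

section \<open>Joint measurability in parameter and sample\<close>

lemma borel_measurable_caratheodory:
  fixes f :: "'a::{metric_space, second_countable_topology} \<Rightarrow> 'z \<Rightarrow> real"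
  assumes cont: "\<And>z x. z \<in> space N \<Longrightarrow> isCont (\<lambda>x. f x z) x"
    and meas: "\<And>x. f x \<in> borel_measurable N"
  shows "(\<lambda>(x, z). f x z) \<in> borel_measurable (borel \<Otimes>\<^sub>M N)"
proof -
  have "id \<in> borel_measurable (borel :: 'a measure)" by simp
  \<comment> \<open>Simple functions \<open>q k\<close> tend to the identity. Replacing x by
    \<open>q k x\<close> leaves finitely many sections, each measurable in z, and continuity in x
    carries measurability to the limit.\<close>
  from borel_measurable_implies_sequence_metric[OF this, of undefined]
  obtain q :: "nat \<Rightarrow> 'a \<Rightarrow> 'a" where q: "\<And>k. simple_function borel (q k)" "\<And>x. (\<lambda>k. q k x) \<longlonglongrightarrow> x"
    by (auto simp: space_borel)
  show ?thesis
  proof (rule borel_measurable_LIMSEQ_metric)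
    fix k
    have fin: "finite (range (q k))" using q(1)[of k] by (simp add: simple_function_def)
    have "(\<lambda>p. f (q k (fst p)) (snd p)) \<in> borel_measurable (borel \<Otimes>\<^sub>M N)"
    proof (rule measurable_compose_countable'[where g = "\<lambda>p. q k (fst p)" and I = "range (q k)"])
      show "(\<lambda>p. q k (fst p)) \<in> measurable (borel \<Otimes>\<^sub>M N) (count_space (range (q k)))"
        using q(1)[of k] fin by (intro measurable_compose[OF measurable_fst])
          (auto simp: measurable_count_space_eq2 simple_function_def)
    qed (use fin meas in \<open>auto intro: countable_finite measurable_compose[OF measurable_snd]\<close>)
    then show "(\<lambda>(x, z). f (q k x) z) \<in> borel_measurable (borel \<Otimes>\<^sub>M N)"
      by (simp add: case_prod_beta)
  next
    fix p :: "'a \<times> 'z" assume "p \<in> space (borel \<Otimes>\<^sub>M N)"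
    then show "(\<lambda>k. (\<lambda>(x, z). f (q k x) z) p) \<longlonglongrightarrow> (\<lambda>(x, z). f x z) p"
      using cont q(2) by (auto simp: space_pair_measure case_prod_beta intro!: isCont_tendsto_compose[OF cont])
  qed
qed

text \<open>Each component is a limit of difference quotients with increments 1 / (k + 1). These are
  jointly measurable because differentiability in x supplies the continuity that
  \<open>borel_measurable_caratheodory\<close> asks for.\<close>

lemma borel_measurable_gradient:
  fixes f :: "'a::euclidean_space \<Rightarrow> 'z \<Rightarrow> real"
  assumes diff: "\<And>z x. z \<in> space N \<Longrightarrow> (\<lambda>x. f x z) differentiable (at x)"
    and meas: "\<And>x. f x \<in> borel_measurable N"
  shows "(\<lambda>(x, z). gradient (\<lambda>x. f x z) x) \<in> borel_measurable (borel \<Otimes>\<^sub>M N)"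
proof (rule borel_measurable_euclidean_space[THEN iffD2], rule ballI)
  fix b :: 'a assume "b \<in> Basis"
  have [measurable]: "(\<lambda>(x, z). f x z) \<in> borel_measurable (borel \<Otimes>\<^sub>M N)"
    by (intro borel_measurable_caratheodory differentiable_imp_continuous_within diff meas)
  define h :: "nat \<Rightarrow> real" where "h k = inverse (real (Suc k))" for k
  show "(\<lambda>p. (case p of (x, z) \<Rightarrow> gradient (\<lambda>x. f x z) x) \<bullet> b) \<in> borel_measurable (borel \<Otimes>\<^sub>M N)"
  proof (rule borel_measurable_LIMSEQ_metric)
    fix k
    have "(\<lambda>p. (\<lambda>(x, z). f x z) (fst p + h k *\<^sub>R b, snd p)) \<in> borel_measurable (borel \<Otimes>\<^sub>M N)"
      by measurable
    moreover have "(\<lambda>p. (\<lambda>(x, z). f x z) p) \<in> borel_measurable (borel \<Otimes>\<^sub>M N)"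
      by measurable
    ultimately show "(\<lambda>p. ((\<lambda>(x, z). f x z) (fst p + h k *\<^sub>R b, snd p) - (\<lambda>(x, z). f x z) p) / h k)
        \<in> borel_measurable (borel \<Otimes>\<^sub>M N)"
      by (intro borel_measurable_divide borel_measurable_diff) auto
  next
    fix p :: "'a \<times> 'z" assume p: "p \<in> space (borel \<Otimes>\<^sub>M N)"
    have "((\<lambda>s. f (fst p + s *\<^sub>R b) (snd p)) has_real_derivative
        b \<bullet> gradient (\<lambda>x. f x (snd p)) (fst p + 0 *\<^sub>R b)) (at 0)"
      using p by (intro gderiv_along_line[where s = 0] diff) (auto simp: space_pair_measure)
    then have "((\<lambda>s. (f (fst p + s *\<^sub>R b) (snd p) - f (fst p) (snd p)) / s) \<longlongrightarrow>
        b \<bullet> gradient (\<lambda>x. f x (snd p)) (fst p)) (at 0)"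
      by (simp add: DERIV_def)
    moreover have "filterlim h (at 0) sequentially"
      unfolding h_def filterlim_at using LIMSEQ_inverse_real_of_nat by auto
    ultimately show "(\<lambda>k. ((\<lambda>(x, z). f x z) (fst p + h k *\<^sub>R b, snd p) - (\<lambda>(x, z). f x z) p) / h k)
        \<longlonglongrightarrow> (case p of (x, z) \<Rightarrow> gradient (\<lambda>x. f x z) x) \<bullet> b"
      by (auto simp: case_prod_beta inner_commute dest: filterlim_compose)
  qed
qed

lemma gderiv_avg:
  fixes F :: "'n::finite \<Rightarrow> 'a::euclidean_space \<Rightarrow> real"
  assumes "\<And>i. F i differentiable (at x)"
  shows "GDERIV (\<lambda>x. avg (\<lambda>i. F i x)) x :> avg (\<lambda>i. gradient (F i) x)"
proof -
  have "((\<lambda>x. avg (\<lambda>i. F i x)) has_derivative (\<lambda>h. avg (\<lambda>i. h \<bullet> gradient (F i) x))) (at x)"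
    unfolding avg_def
    using gderiv_gradient[OF assms] unfolding gderiv_def
    by (intro has_derivative_scaleR_right has_derivative_sum) auto
  then show ?thesis by (simp add: gderiv_def avg_def inner_sum_right)
qed

lemma gradient_at_minimum:
  fixes f :: "'a::euclidean_space \<Rightarrow> real"
  assumes diff: "\<And>x. f differentiable (at x)"
    and min: "\<And>y. f x \<le> f y"
  shows "gradient f x = 0"
proof -
  have "(f has_derivative (\<lambda>h. h \<bullet> gradient f x)) (at x)"
    using gderiv_gradient[OF diff] by (simp add: gderiv_def)
  then have "(\<lambda>h. h \<bullet> gradient f x) = (\<lambda>h. 0)"
    by (intro differential_zero_maxmin[of x UNIV f]) (use min in auto)
  then show ?thesis by (metis inner_eq_zero_iff)
qed

section \<open>Mixing matrices\<close>

text \<open>\<open>U ** transpose U\<close> is the orthogonal projection onto the zero-sum vectors,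
  and W preserves this subspace because its columns sum to one. Hence W x = U (U^T W U) U^T x for
  zero-sum x, and it remains to see that U and its transpose do not increase norms.\<close>

lemma mixing_contraction:
  fixes W :: "real^'n^'n" and U :: "real^'m^'n" and x :: "real^'n"
  assumes W: "doubly_stochastic W"
    and U: "mat 1 - (\<chi> i j. 1 / real CARD('n)) = U ** transpose U"
    and gap: "spectral_norm (transpose U ** W ** U) \<le> 1 - \<rho>"
    and x: "(\<Sum>i\<in>UNIV. x $ i) = 0"
  shows "norm (W *v x) \<le> (1 - \<rho>) * norm x"
proof -
  have proj: "U *v (transpose U *v u) = u - (\<chi> i. (\<Sum>j\<in>UNIV. u $ j) / real CARD('n))" for u :: "real^'n"
    unfolding matrix_vector_mul_assoc U[symmetric]
    by (simp add: matrix_vector_mult_diff_rdistrib)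
      (simp add: matrix_vector_mult_def vec_eq_iff sum_divide_distrib)
  have dual: "u \<bullet> (U *v v) = (transpose U *v u) \<bullet> v" for u v
    by (simp add: dot_lmul_matrix transpose_matrix_vector)
  have Ut: "norm (transpose U *v u) \<le> norm u" for u :: "real^'n"
  proof -
    have "(norm (transpose U *v u))\<^sup>2 = u \<bullet> (U *v (transpose U *v u))"
      by (simp add: dual power2_norm_eq_inner)
    also have "\<dots> = (norm u)\<^sup>2 - (\<Sum>j\<in>UNIV. u $ j)\<^sup>2 / real CARD('n)"
      unfolding proj
      by (simp add: inner_diff_right power2_norm_eq_inner)
        (simp add: inner_vec_def power2_eq_square flip: sum_distrib_right sum_divide_distrib)
    also have "\<dots> \<le> (norm u)\<^sup>2" by simp
    finally show ?thesis by (rule power2_le_imp_le) simp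
  qed
  \<comment> \<open>Duality with \<open>Ut\<close>: the square of |U v| equals the inner product of
    U^T U v with v, hence is at most |U v| |v|. Cancelling |U v| forces the case split.\<close>
  have U_le: "norm (U *v v) \<le> norm v" for v
  proof (cases "norm (U *v v) = 0")
    case False
    have "norm (U *v v) * norm (U *v v) = (transpose U *v (U *v v)) \<bullet> v"
      by (simp add: power2_norm_eq_inner dual flip: power2_eq_square)
    also have "\<dots> \<le> norm (U *v v) * norm v"
      by (rule order_trans[OF norm_cauchy_schwarz mult_right_mono[OF Ut norm_ge_zero]])
    finally show ?thesis using False by (simp add: mult_le_cancel_left)
  qed simp
  have "(\<Sum>i\<in>UNIV. (W *v x) $ i) = (transpose W *v 1) \<bullet> x"
    unfolding transpose_matrix_vector dot_lmul_matrix by (simp add: inner_vec_def)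
  also have "\<dots> = 0" using W x by (simp add: doubly_stochastic_def inner_vec_def)
  finally have Wx: "W *v x = U *v (transpose U *v (W *v x))" unfolding proj by (simp flip: zero_vec_def)
  have Ux: "U *v (transpose U *v x) = x" unfolding proj by (simp add: x flip: zero_vec_def)
  have "W *v x = U *v (transpose U *v (W *v (U *v (transpose U *v x))))" unfolding Ux by (rule Wx)
  then have "W *v x = U *v ((transpose U ** W ** U) *v (transpose U *v x))"
    by (simp only: matrix_vector_mul_assoc matrix_mul_assoc)
  then have "norm (W *v x) \<le> norm ((transpose U ** W ** U) *v (transpose U *v x))"
    using U_le by metis
  also have "\<dots> \<le> spectral_norm (transpose U ** W ** U) * norm (transpose U *v x)"
    unfolding spectral_norm_def by (rule onorm) (rule matrix_vector_mul_bounded_linear)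
  \<comment> \<open>\<open>1 - \<rho>\<close> is nonnegative because it bounds an operator
    norm.\<close>
  also have "\<dots> \<le> (1 - \<rho>) * norm x"
    by (rule mult_mono[OF gap Ut order_trans[OF _ gap]])
      (auto simp: spectral_norm_def intro!: onorm_pos_le matrix_vector_mul_bounded_linear)
  finally show ?thesis .
qed

lemma norm_power2_vec: "(norm (v :: real^'d))\<^sup>2 = (\<Sum>k\<in>UNIV. (v $ k)\<^sup>2)"
  unfolding power2_norm_eq_inner by (simp add: inner_vec_def power2_eq_square)

text \<open>Both sides split over coordinates: W acts on the k-th coordinates of all agents,
  collected in \<open>x k\<close>, exactly as in \<open>mixing_contraction\<close>.\<close>

lemma mixing_contraction_family:
  fixes W :: "real^'n^'n" and U :: "real^'m^'n" and v :: "'n \<Rightarrow> real^'d"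
  assumes W: "doubly_stochastic W"
    and U: "mat 1 - (\<chi> i j. 1 / real CARD('n)) = U ** transpose U"
    and gap: "spectral_norm (transpose U ** W ** U) \<le> 1 - \<rho>"
    and v: "(\<Sum>i\<in>UNIV. v i) = 0"
  shows "(\<Sum>i\<in>UNIV. (norm (\<Sum>j\<in>UNIV. W $ i $ j *\<^sub>R v j))\<^sup>2) \<le> (1 - \<rho>)\<^sup>2 * (\<Sum>i\<in>UNIV. (norm (v i))\<^sup>2)"
proof -
  define x where "x k = (\<chi> i. v i $ k)" for k
  have "(\<Sum>i\<in>UNIV. (norm (\<Sum>j\<in>UNIV. W $ i $ j *\<^sub>R v j))\<^sup>2) = (\<Sum>i\<in>UNIV. \<Sum>k\<in>UNIV. ((W *v x k) $ i)\<^sup>2)"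
    by (simp add: norm_power2_vec x_def matrix_vector_mult_def)
  also have "\<dots> = (\<Sum>k\<in>UNIV. (norm (W *v x k))\<^sup>2)"
    by (subst sum.swap) (simp add: norm_power2_vec)
  also have "\<dots> \<le> (\<Sum>k\<in>UNIV. ((1 - \<rho>) * norm (x k))\<^sup>2)"
  proof (intro sum_mono power_mono mixing_contraction[OF W U gap])
    fix k show "(\<Sum>i\<in>UNIV. x k $ i) = 0"
      using arg_cong[OF v, of "\<lambda>u. u $ k"] by (simp add: x_def)
  qed simp
  also have "\<dots> = (1 - \<rho>)\<^sup>2 * (\<Sum>k\<in>UNIV. \<Sum>i\<in>UNIV. (v i $ k)\<^sup>2)"
    by (simp add: power_mult_distrib sum_distrib_left norm_power2_vec x_def)
  also have "\<dots> = (1 - \<rho>)\<^sup>2 * (\<Sum>i\<in>UNIV. (norm (v i))\<^sup>2)"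
    by (subst sum.swap) (simp add: norm_power2_vec)
  finally show ?thesis .
qed

section \<open>Averages and quadratic inequalities\<close>

lemma norm_avg_power2_le:
  fixes x :: "'n::finite \<Rightarrow> 'a::real_inner"
  shows "(norm (avg x))\<^sup>2 \<le> (\<Sum>i\<in>UNIV. (norm (x i))\<^sup>2) / real CARD('n)"
proof -
  have "(norm (\<Sum>i\<in>UNIV. x i))\<^sup>2 \<le> (\<Sum>i\<in>UNIV. norm (x i) * 1)\<^sup>2"
    by (intro power_mono) (auto simp: norm_sum)
  also have "\<dots> \<le> (\<Sum>i\<in>UNIV. (norm (x i))\<^sup>2) * (\<Sum>i\<in>(UNIV::'n set). 1\<^sup>2)"
    by (rule Cauchy_Schwarz_ineq_sum)
  finally show ?thesis
    by (simp add: avg_def power_divide power2_eq_square[of "real _"] field_simps)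
qed

lemma sum_deviation_avg:
  fixes x :: "'n::finite \<Rightarrow> 'a::real_vector"
  shows "(\<Sum>i\<in>UNIV. (x i - avg x)) = 0"
  by (simp add: sum_subtractf avg_def sum_constant_scaleR)

text \<open>Deviations from the mean sum to zero, which removes the cross term. In
  \<open>consensus_step\<close> this trades the average of the noisy gradients for
  \<open>gradient f\<close> at the averaged iterate.\<close>

lemma sum_deviation_power2_le:
  fixes x :: "'n::finite \<Rightarrow> 'a::real_inner"
  shows "(\<Sum>i\<in>UNIV. (norm (x i - avg x))\<^sup>2) \<le> (\<Sum>i\<in>UNIV. (norm (x i - c))\<^sup>2)"
proof -
  have z: "(\<Sum>i\<in>UNIV. (x i - avg x) \<bullet> (avg x - c)) = 0"
    by (simp add: sum_deviation_avg flip: inner_sum_left)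
  have "(norm (x i - c))\<^sup>2 = (norm (x i - avg x))\<^sup>2 + 2 * ((x i - avg x) \<bullet> (avg x - c)) + (norm (avg x - c))\<^sup>2" for i
    by (simp add: power2_norm_eq_inner inner_simps inner_commute)
  then show ?thesis by (simp add: sum.distrib z flip: sum_distrib_left)
qed

text \<open>Young's inequality, from expanding the square of |\<alpha> a - b| divided by \<alpha>.
  The weight stays free so that it can be matched to the spectral gap.\<close>

lemma power2_norm_add_le:
  fixes a b :: "'a::real_inner"
  assumes "0 < \<alpha>"
  shows "(norm (a + b))\<^sup>2 \<le> (1 + \<alpha>) * (norm a)\<^sup>2 + (1 + 1 / \<alpha>) * (norm b)\<^sup>2"
proof -
  have "0 \<le> (norm (\<alpha> *\<^sub>R a - b))\<^sup>2 / \<alpha>" using assms by simp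
  also have "\<dots> = \<alpha> * (norm a)\<^sup>2 - 2 * (a \<bullet> b) + (norm b)\<^sup>2 / \<alpha>"
    using assms by (simp add: power2_norm_eq_inner inner_simps inner_commute field_simps)
  finally show ?thesis by (simp add: power2_norm_eq_inner inner_simps inner_commute field_simps)
qed

lemma power2_norm_add3_le:
  fixes a b c :: "'a::real_inner"
  shows "(norm (a + b + c))\<^sup>2 \<le> 3 * ((norm a)\<^sup>2 + (norm b)\<^sup>2 + (norm c)\<^sup>2)"
proof -
  have "0 \<le> (norm (a - b))\<^sup>2 + (norm (b - c))\<^sup>2 + (norm (a - c))\<^sup>2" by simp
  then show ?thesis by (simp add: power2_norm_eq_inner inner_simps inner_commute)
qed

text \<open>Here the column sums matter: mixing does not move the average. The row sums enter in
  \<open>mixing_const\<close>, by which a consensus is a fixed point.\<close>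

lemma avg_mixing:
  fixes W :: "real^'n^'n" and x :: "'n \<Rightarrow> 'a::real_vector"
  assumes "doubly_stochastic W"
  shows "avg (\<lambda>i. \<Sum>j\<in>UNIV. W $ i $ j *\<^sub>R x j) = avg x"
proof -
  have "(\<Sum>i\<in>UNIV. W $ i $ j) = 1" for j
    using assms by (simp add: doubly_stochastic_def matrix_vector_mult_def transpose_def vec_eq_iff)
  then have "(\<Sum>i\<in>UNIV. \<Sum>j\<in>UNIV. W $ i $ j *\<^sub>R x j) = (\<Sum>j\<in>UNIV. x j)"
    by (subst sum.swap) (simp flip: scaleR_sum_left)
  then show ?thesis by (simp add: avg_def)
qed

lemma mixing_const:
  fixes W :: "real^'n^'n" and c :: "'a::real_vector"
  assumes "doubly_stochastic W"
  shows "(\<Sum>j\<in>UNIV. W $ i $ j *\<^sub>R c) = c"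
proof -
  have "(\<Sum>j\<in>UNIV. W $ i $ j) = 1"
    using assms by (simp add: doubly_stochastic_def matrix_vector_mult_def vec_eq_iff)
  then show ?thesis by (simp flip: scaleR_sum_left)
qed

lemma avg_linear:
  "avg (\<lambda>i. x i + y i) = avg x + avg y"
  "avg (\<lambda>i. x i - y i) = avg x - avg y"
  "avg (\<lambda>i. r *\<^sub>R x i) = r *\<^sub>R avg x"
  "avg (\<lambda>i::'n::finite. c) = c"
  by (simp_all add: avg_def sum.distrib sum_subtractf algebra_simps sum_constant_scaleR flip: scaleR_sum_right)

section \<open>Stochastic gradient noise\<close>

text \<open>A class closed under the operations of the recursion in which inner products are
  integrable, as the cross terms require. Measurability is included since that of the norm does not
  imply that of the vector.\<close>

definition square_integrable :: "'w measure \<Rightarrow> ('w \<Rightarrow> 'a::euclidean_space) \<Rightarrow> bool" where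
  "square_integrable M X \<longleftrightarrow> X \<in> borel_measurable M \<and> integrable M (\<lambda>\<omega>. (norm (X \<omega>))\<^sup>2)"

lemma square_integrable_inner:
  assumes "square_integrable M X" "square_integrable M Y"
  shows "integrable M (\<lambda>\<omega>. X \<omega> \<bullet> Y \<omega>)"
proof (rule Bochner_Integration.integrable_bound)
  show "integrable M (\<lambda>\<omega>. (norm (X \<omega>))\<^sup>2 + (norm (Y \<omega>))\<^sup>2)"
    using assms by (simp add: square_integrable_def)
  show "(\<lambda>\<omega>. X \<omega> \<bullet> Y \<omega>) \<in> borel_measurable M"
    using assms by (auto simp: square_integrable_def)
  show "AE \<omega> in M. norm (X \<omega> \<bullet> Y \<omega>) \<le> norm ((norm (X \<omega>))\<^sup>2 + (norm (Y \<omega>))\<^sup>2)"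
  proof (rule AE_I2)
    fix \<omega>
    have "\<bar>X \<omega> \<bullet> Y \<omega>\<bar> \<le> norm (X \<omega>) * norm (Y \<omega>)" by (rule Cauchy_Schwarz_ineq2)
    also have "\<dots> \<le> (norm (X \<omega>))\<^sup>2 + (norm (Y \<omega>))\<^sup>2"
      using sum_squares_bound[of "norm (X \<omega>)" "norm (Y \<omega>)"]
        mult_nonneg_nonneg[OF norm_ge_zero[of "X \<omega>"] norm_ge_zero[of "Y \<omega>"]] by linarith
    finally show "norm (X \<omega> \<bullet> Y \<omega>) \<le> norm ((norm (X \<omega>))\<^sup>2 + (norm (Y \<omega>))\<^sup>2)" by simp
  qed
qed

lemma square_integrable_add:
  assumes X: "square_integrable M X" and Y: "square_integrable M Y"
  shows "square_integrable M (\<lambda>\<omega>. X \<omega> + Y \<omega>)"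
proof -
  have "(norm (X \<omega> + Y \<omega>))\<^sup>2 = (norm (X \<omega>))\<^sup>2 + 2 * (X \<omega> \<bullet> Y \<omega>) + (norm (Y \<omega>))\<^sup>2" for \<omega>
    by (simp add: power2_norm_eq_inner inner_simps inner_commute)
  moreover have "integrable M (\<lambda>\<omega>. (norm (X \<omega>))\<^sup>2 + 2 * (X \<omega> \<bullet> Y \<omega>) + (norm (Y \<omega>))\<^sup>2)"
    using square_integrable_inner[OF X Y] X Y by (simp add: square_integrable_def)
  ultimately show ?thesis using X Y by (auto simp: square_integrable_def)
qed

lemma square_integrable_scaleR:
  "square_integrable M X \<Longrightarrow> square_integrable M (\<lambda>\<omega>. r *\<^sub>R X \<omega>)"
  by (auto simp: square_integrable_def power_mult_distrib)

lemma square_integrable_diff: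
  assumes "square_integrable M X" "square_integrable M Y"
  shows "square_integrable M (\<lambda>\<omega>. X \<omega> - Y \<omega>)"
  using square_integrable_add[OF assms(1) square_integrable_scaleR[OF assms(2), of "-1"]] by simp

lemma square_integrable_sum:
  "(\<And>i. i \<in> A \<Longrightarrow> square_integrable M (X i)) \<Longrightarrow> square_integrable M (\<lambda>\<omega>. \<Sum>i\<in>A. X i \<omega>)"
  by (induction A rule: infinite_finite_induct)
    (auto intro: square_integrable_add simp: square_integrable_def[of M "\<lambda>_. 0"])

lemma square_integrable_avg:
  "(\<And>i. square_integrable M (X i)) \<Longrightarrow> square_integrable M (\<lambda>\<omega>. avg (\<lambda>i. X i \<omega>))"
  unfolding avg_def by (intro square_integrable_scaleR square_integrable_sum)

lemma lipschitz_constant_nonneg: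
  fixes F :: "'b::euclidean_space \<Rightarrow> 'c::real_normed_vector"
  assumes F: "\<And>x y. norm (F y - F x) \<le> L * norm (y - x)"
  shows "0 \<le> L"
proof -
  have "0 \<le> L * norm (One::'b)" using F[of One 0] by (metis diff_zero norm_ge_zero order_trans)
  then show ?thesis by (simp add: zero_le_mult_iff)
qed

lemma borel_measurable_lipschitz:
  fixes F :: "'b::euclidean_space \<Rightarrow> 'c::real_normed_vector"
  assumes F: "\<And>x y. norm (F y - F x) \<le> L * norm (y - x)"
  shows "F \<in> borel_measurable borel"
  by (intro borel_measurable_continuous_onI lipschitz_on_continuous_on[of L])
    (use F lipschitz_constant_nonneg[OF F] in \<open>auto simp: lipschitz_on_def dist_norm\<close>)

text \<open>A Lipschitz map grows at most linearly, and the constant part of the bound is integrable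
  because the measure is finite.\<close>

lemma (in prob_space) square_integrable_lipschitz:
  fixes F :: "'b::euclidean_space \<Rightarrow> 'c::euclidean_space"
  assumes F: "\<And>x y. norm (F y - F x) \<le> L * norm (y - x)" and X: "square_integrable M X"
  shows "square_integrable M (\<lambda>\<omega>. F (X \<omega>))"
proof -
  have bd: "(norm (F x))\<^sup>2 \<le> 2 * (norm (F 0))\<^sup>2 + 2 * L\<^sup>2 * (norm x)\<^sup>2" for x
  proof -
    have "(norm (F 0 + (F x - F 0)))\<^sup>2 \<le> 2 * (norm (F 0))\<^sup>2 + 2 * (norm (F x - F 0))\<^sup>2"
      using power2_norm_add_le[of 1 "F 0" "F x - F 0"] by simp
    also have "(norm (F x - F 0))\<^sup>2 \<le> (L * norm x)\<^sup>2"
      using F[of x 0] by (intro power_mono) auto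
    finally show ?thesis by (simp add: power_mult_distrib)
  qed
  note meas = borel_measurable_lipschitz[OF F]
  have "integrable M (\<lambda>\<omega>. 2 * (norm (F 0))\<^sup>2 + 2 * L\<^sup>2 * (norm (X \<omega>))\<^sup>2)"
    using X by (simp add: square_integrable_def)
  moreover have "(\<lambda>\<omega>. F (X \<omega>)) \<in> borel_measurable M"
    using X meas by (auto simp: square_integrable_def)
  ultimately show ?thesis
    unfolding square_integrable_def using bd
    by (auto elim!: Bochner_Integration.integrable_bound)
qed

text \<open>Adaptedness as a pathwise statement. It allows an iterate to be recomputed from a tuple
  in which a later sample is missing.\<close>

lemma dsgd_cong:
  assumes "\<And>s j. 1 \<le> s \<Longrightarrow> s \<le> t \<Longrightarrow> z s j = z' s j"
  shows "dsgd W \<gamma> loss \<theta>0 z t i = dsgd W \<gamma> loss \<theta>0 z' t i"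
  using assms
proof (induction t arbitrary: i)
  case (Suc t)
  then have "dsgd W \<gamma> loss \<theta>0 z t j = dsgd W \<gamma> loss \<theta>0 z' t j" for j by simp
  with Suc.prems show ?case by simp
qed simp

text \<open>The measurable space N is arbitrary because the lemma serves on \<open>M\<close>, on the
  product space lacking one sample, and on the sigma-algebra generated by the samples.\<close>

lemma borel_measurable_dsgd:
  fixes loss :: "'n::finite \<Rightarrow> 'a::euclidean_space \<Rightarrow> 'z \<Rightarrow> real"
  assumes diff: "\<And>i z x. z \<in> space (B i) \<Longrightarrow> (\<lambda>x. loss i x z) differentiable (at x)"
    and meas: "\<And>i x. loss i x \<in> borel_measurable (B i)"
    and z: "\<And>s j. 1 \<le> s \<Longrightarrow> s \<le> t \<Longrightarrow> z s j \<in> measurable N (B j)"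
  shows "(\<lambda>\<omega>. dsgd W \<gamma> loss \<theta>0 (\<lambda>s j. z s j \<omega>) t i) \<in> borel_measurable N"
  using z
proof (induction t arbitrary: i)
  case (Suc t)
  have IH[measurable]: "(\<lambda>\<omega>. dsgd W \<gamma> loss \<theta>0 (\<lambda>s j. z s j \<omega>) t j) \<in> borel_measurable N" for j
    using Suc by simp
  have [measurable]: "z (Suc t) i \<in> measurable N (B i)" using Suc.prems by simp
  have [measurable]: "(\<lambda>(x, z). gradient (\<lambda>x. loss i x z) x) \<in> borel_measurable (borel \<Otimes>\<^sub>M B i)"
    by (rule borel_measurable_gradient[OF diff meas])
  have "(\<lambda>\<omega>. (\<lambda>(x, z). gradient (\<lambda>x. loss i x z) x)
      (dsgd W \<gamma> loss \<theta>0 (\<lambda>s j. z s j \<omega>) t i, z (Suc t) i \<omega>)) \<in> borel_measurable N"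
    by measurable
  then show ?case by simp
qed simp

text \<open>The probabilistic layer: \<open>F\<close> is the mean of the sampled gradients, without
  reference yet to an objective or to the mixing properties of \<open>W\<close>.\<close>

locale dsgd_process = prob_space M for M :: "'w measure" +
  fixes W :: "real^'n^'n" and \<gamma> :: "nat \<Rightarrow> real" and c :: real
    and loss :: "'n \<Rightarrow> real^'d \<Rightarrow> 'z \<Rightarrow> real" and \<theta>0 :: "'n \<Rightarrow> real^'d"
    and B :: "'n \<Rightarrow> 'z measure" and Z :: "nat \<Rightarrow> 'n \<Rightarrow> 'w \<Rightarrow> 'z"
    and F :: "'n \<Rightarrow> real^'d \<Rightarrow> real^'d" and \<sigma> L :: real
  assumes prob_B: "\<And>i. prob_space (B i)"
    and step: "\<And>t. \<gamma> (Suc t) = c"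
    and loss_differentiable: "\<And>i \<theta> z. z \<in> space (B i) \<Longrightarrow> (\<lambda>\<theta>. loss i \<theta> z) differentiable (at \<theta>)"
    and loss_measurable: "\<And>i \<theta>. loss i \<theta> \<in> borel_measurable (B i)"
    and samples: "independent_samples M B Z"
    and unbiased: "\<And>i \<theta>. has_bochner_integral (B i) (\<lambda>z. gradient (\<lambda>\<theta>. loss i \<theta> z) \<theta>) (F i \<theta>)"
    and second_moment_integrable: "\<And>i \<theta>. integrable (B i)
          (\<lambda>z. (norm (gradient (\<lambda>\<theta>. loss i \<theta> z) \<theta> - F i \<theta>))\<^sup>2)"
    and second_moment: "\<And>i \<theta>.
          (\<integral>z. (norm (gradient (\<lambda>\<theta>. loss i \<theta> z) \<theta> - F i \<theta>))\<^sup>2 \<partial>B i) \<le> \<sigma>\<^sup>2"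
    and F_lipschitz: "\<And>i \<theta> \<theta>'. norm (F i \<theta>' - F i \<theta>) \<le> L * norm (\<theta>' - \<theta>)"
begin

definition X :: "nat \<Rightarrow> 'n \<Rightarrow> 'w \<Rightarrow> real^'d" where
  "X t i \<omega> = dsgd W \<gamma> loss \<theta>0 (\<lambda>s j. Z s j \<omega>) t i"

definition noise :: "'n \<Rightarrow> real^'d \<Rightarrow> 'z \<Rightarrow> real^'d" where
  "noise i \<theta> z = gradient (\<lambda>\<theta>. loss i \<theta> z) \<theta> - F i \<theta>"

text \<open>The noise of the move from t to t + 1, hence the fresh sample with index
  \<open>Suc t\<close>, evaluated at an iterate that has seen only earlier samples.\<close>

definition \<xi> :: "nat \<Rightarrow> 'n \<Rightarrow> 'w \<Rightarrow> real^'d" where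
  "\<xi> t i \<omega> = noise i (X t i \<omega>) (Z (Suc t) i \<omega>)"

text \<open>All samples except the one that drives \<open>\<xi> t i\<close>. Besides the iterates up to time \<open>t\<close> they
  determine the simultaneous noise of the other agents, so one independence statement gives both
  kinds of orthogonality.\<close>

definition others :: "nat \<Rightarrow> 'n \<Rightarrow> (nat \<times> 'n) set" where
  "others t i = {1..} \<times> UNIV - {(Suc t, i)}"

definition other_samples :: "nat \<Rightarrow> 'n \<Rightarrow> 'w \<Rightarrow> nat \<times> 'n \<Rightarrow> 'z" where
  "other_samples t i \<omega> = restrict (\<lambda>(s, j). Z s j \<omega>) (others t i)"

abbreviation other_space :: "nat \<Rightarrow> 'n \<Rightarrow> (nat \<times> 'n \<Rightarrow> 'z) measure" where
  "other_space t i \<equiv> PiM (others t i) (\<lambda>(s, j). B j)"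

text \<open>The iterate as a deterministic function of a tuple of samples, through which
  \<open>X\<close> factors. Tuples in \<open>other_space t i\<close> have no entry at
  \<open>(Suc t, i)\<close>, which is harmless up to time t.\<close>

definition X_of :: "nat \<Rightarrow> 'n \<Rightarrow> (nat \<times> 'n \<Rightarrow> 'z) \<Rightarrow> real^'d" where
  "X_of t i g = dsgd W \<gamma> loss \<theta>0 (\<lambda>s j. g (s, j)) t i"

lemma Z_measurable[measurable]: "Z (Suc t) i \<in> measurable M (B i)"
  using samples by (simp add: independent_samples_def)

lemma Z_measurable': "1 \<le> t \<Longrightarrow> Z t i \<in> measurable M (B i)"
  using samples by (simp add: independent_samples_def)

lemma X_measurable[measurable]: "X t i \<in> borel_measurable M"
  unfolding X_def
  by (rule borel_measurable_dsgd[OF loss_differentiable loss_measurable Z_measurable'])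

lemma F_measurable[measurable]: "F i \<in> borel_measurable borel"
  by (rule borel_measurable_lipschitz[OF F_lipschitz])

lemma noise_measurable[measurable]: "(\<lambda>(x, z). noise i x z) \<in> borel_measurable (borel \<Otimes>\<^sub>M B i)"
proof -
  have [measurable]: "(\<lambda>(x, z). gradient (\<lambda>x. loss i x z) x) \<in> borel_measurable (borel \<Otimes>\<^sub>M B i)"
    by (rule borel_measurable_gradient[OF loss_differentiable loss_measurable])
  have "(\<lambda>p. (\<lambda>(x, z). gradient (\<lambda>x. loss i x z) x) p - F i (fst p)) \<in> borel_measurable (borel \<Otimes>\<^sub>M B i)"
    by measurable
  then show ?thesis by (simp add: noise_def case_prod_beta)
qed

lemma \<xi>_measurable[measurable]: "\<xi> t i \<in> borel_measurable M"
proof -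
  have "(\<lambda>\<omega>. (\<lambda>(x, z). noise i x z) (X t i \<omega>, Z (Suc t) i \<omega>)) \<in> borel_measurable M"
    by measurable
  then show ?thesis by (simp add: \<xi>_def[abs_def])
qed

lemma X_of_measurable: "s \<le> t \<Longrightarrow> X_of s j \<in> borel_measurable (other_space t i)"
  unfolding X_of_def[abs_def]
proof (rule borel_measurable_dsgd[OF loss_differentiable loss_measurable])
  fix r k assume "1 \<le> r" "r \<le> s" "s \<le> t"
  then have "(r, k) \<in> others t i" by (auto simp: others_def)
  from measurable_component_singleton[OF this, of "\<lambda>(s, j). B j"]
  show "(\<lambda>g. g (r, k)) \<in> measurable (other_space t i) (B k)" by simp
qed

lemma X_of_other_samples: "s \<le> t \<Longrightarrow> X_of s j (other_samples t i \<omega>) = X s j \<omega>"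
  unfolding X_of_def X_def by (rule dsgd_cong) (auto simp: other_samples_def others_def)

lemma other_samples_measurable[measurable]:
  "other_samples t i \<in> measurable M (other_space t i)"
  unfolding other_samples_def
  by (rule measurable_restrict) (auto simp: others_def intro: Z_measurable')

text \<open>Disjoint blocks of an independent family are independent. All orthogonality and moment
  statements about the noise rest on this product law.\<close>

lemma distr_other_samples_pair:
  "distr M (other_space t i \<Otimes>\<^sub>M B i) (\<lambda>\<omega>. (other_samples t i \<omega>, Z (Suc t) i \<omega>))
    = distr M (other_space t i) (other_samples t i) \<Otimes>\<^sub>M B i"
proof -
  have ind: "indep_vars (\<lambda>(t, i). B i) (\<lambda>(t, i). Z t i) ({1..} \<times> UNIV)"
    and d: "distr M (B i) (Z (Suc t) i) = B i"
    using samples by (auto simp: independent_samples_def)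
  let ?p = "(Suc t, i)"
  let ?P = "other_space t i" and ?Q = "PiM {?p} (\<lambda>(s, j). B j)"
  let ?\<mu> = "distr M ?P (other_samples t i)"
  \<comment> \<open>Block independence speaks of tuples, so the single sample first appears as a
    one-point tuple. Evaluation at \<open>?p\<close> then recovers the law
    \<open>B i\<close>.\<close>
  define r where "r \<omega> = restrict (\<lambda>(s, j). Z s j \<omega>) {?p}" for \<omega>
  have "indep_var ?P (\<lambda>\<omega>. restrict (\<lambda>p. (case p of (s, j) \<Rightarrow> Z s j) \<omega>) (others t i))
     ?Q (\<lambda>\<omega>. restrict (\<lambda>p. (case p of (s, j) \<Rightarrow> Z s j) \<omega>) {?p})"
    by (rule indep_var_restrict[OF ind]) (auto simp: others_def)
  then have "indep_var ?P (other_samples t i) ?Q r"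
    by (simp add: other_samples_def[abs_def] r_def[abs_def] case_prod_beta')
  then have r[measurable]: "r \<in> measurable M ?Q"
    and eq: "distr M ?P (other_samples t i) \<Otimes>\<^sub>M distr M ?Q r
      = distr M (?P \<Otimes>\<^sub>M ?Q) (\<lambda>\<omega>. (other_samples t i \<omega>, r \<omega>))"
    by (auto simp: indep_var_distribution_eq)
  have [measurable]: "(\<lambda>g. g ?p) \<in> measurable ?Q (B i)"
    using measurable_component_singleton[of ?p "{?p}" "\<lambda>(s, j). B j"] by simp
  have rZ: "r \<omega> ?p = Z (Suc t) i \<omega>" for \<omega> by (simp add: r_def)
  have B: "distr (distr M ?Q r) (B i) (\<lambda>g. g ?p) = B i"
    by (subst distr_distr) (simp_all add: comp_def rZ d)
  interpret B: prob_space "B i" by (rule prob_B)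
  have "distr M (?P \<Otimes>\<^sub>M B i) (\<lambda>\<omega>. (other_samples t i \<omega>, Z (Suc t) i \<omega>))
      = distr (?\<mu> \<Otimes>\<^sub>M distr M ?Q r) (?P \<Otimes>\<^sub>M B i) (\<lambda>(x, y). (x, y ?p))"
    unfolding eq by (subst distr_distr) (simp_all add: comp_def rZ)
  also have "\<dots> = distr ?\<mu> ?P (\<lambda>x. x) \<Otimes>\<^sub>M distr (distr M ?Q r) (B i) (\<lambda>g. g ?p)"
    by (rule pair_measure_distr[symmetric]) (simp_all add: B B.sigma_finite_measure_axioms)
  also have "\<dots> = ?\<mu> \<Otimes>\<^sub>M B i"
    by (simp only: B) (subst distr_distr, simp_all add: comp_def)
  finally show ?thesis .
qed

section \<open>Mean, orthogonality and second moment of the noise\<close>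

lemma noise_mean: "has_bochner_integral (B i) (noise i \<theta>) 0"
proof -
  interpret B: prob_space "B i" by (rule prob_B)
  have "has_bochner_integral (B i) (\<lambda>z. gradient (\<lambda>\<theta>. loss i \<theta> z) \<theta> - F i \<theta>) (F i \<theta> - F i \<theta>)"
    by (intro has_bochner_integral_diff unbiased)
      (simp add: has_bochner_integral_iff B.prob_space)
  then show ?thesis by (simp add: noise_def[abs_def])
qed

text \<open>Fubini for the product law: with the other samples frozen, both h and the iterate are
  constants, and the inner integral over the fresh sample is h paired with the zero mean. The
  assumption \<open>int\<close> licenses Fubini.\<close>

lemma noise_orthogonal:
  assumes h: "h \<in> borel_measurable (other_space t i)"
    and int: "integrable M (\<lambda>\<omega>. h (other_samples t i \<omega>) \<bullet> \<xi> t i \<omega>)"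
  shows "(\<integral>\<omega>. h (other_samples t i \<omega>) \<bullet> \<xi> t i \<omega> \<partial>M) = 0"
proof -
  let ?P = "other_space t i" and ?\<mu> = "distr M (other_space t i) (other_samples t i)"
  let ?Y = "\<lambda>\<omega>. (other_samples t i \<omega>, Z (Suc t) i \<omega>)"
  define \<Phi> where "\<Phi> p = h (fst p) \<bullet> noise i (X_of t i (fst p)) (snd p)" for p
  interpret B: prob_space "B i" by (rule prob_B)
  interpret \<mu>: prob_space ?\<mu> by (rule prob_space_distr) simp
  interpret pair_sigma_finite ?\<mu> "B i" ..
  have [measurable]: "h \<in> borel_measurable ?P" "X_of t i \<in> borel_measurable ?P"
    using h X_of_measurable by auto
  have "(\<lambda>p. h (fst p) \<bullet> (\<lambda>(x, z). noise i x z) (X_of t i (fst p), snd p)) \<in> borel_measurable (?P \<Otimes>\<^sub>M B i)"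
    by measurable
  then have \<Phi>[measurable]: "\<Phi> \<in> borel_measurable (?P \<Otimes>\<^sub>M B i)" by (simp add: \<Phi>_def[abs_def])
  have Y[measurable]: "?Y \<in> measurable M (?P \<Otimes>\<^sub>M B i)" by measurable
  have eq: "h (other_samples t i \<omega>) \<bullet> \<xi> t i \<omega> = \<Phi> (?Y \<omega>)" for \<omega>
    by (simp add: \<Phi>_def \<xi>_def X_of_other_samples)
  have "integrable (distr M (?P \<Otimes>\<^sub>M B i) ?Y) \<Phi>"
    using int by (simp add: integrable_distr_eq eq)
  then have "integrable (?\<mu> \<Otimes>\<^sub>M B i) \<Phi>" by (simp add: distr_other_samples_pair)
  then have "integral\<^sup>L (?\<mu> \<Otimes>\<^sub>M B i) \<Phi> = (\<integral>g. (\<integral>z. \<Phi> (g, z) \<partial>B i) \<partial>?\<mu>)"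
    by (rule integral_fst'[symmetric])
  also have "\<dots> = 0"
    using noise_mean by (simp add: \<Phi>_def has_bochner_integral_iff)
  also have "integral\<^sup>L (?\<mu> \<Otimes>\<^sub>M B i) \<Phi> = (\<integral>\<omega>. h (other_samples t i \<omega>) \<bullet> \<xi> t i \<omega> \<partial>M)"
    by (simp add: eq integral_distr flip: distr_other_samples_pair)
  finally show ?thesis .
qed

text \<open>Integrability is part of the claim, so the computation runs with nonnegative integrals:
  Tonelli reduces it to the bound at a frozen parameter, and finiteness gives square integrability
  afterwards.\<close>

lemma \<xi>_second_moment:
  shows "square_integrable M (\<xi> t i)" and "(\<integral>\<omega>. (norm (\<xi> t i \<omega>))\<^sup>2 \<partial>M) \<le> \<sigma>\<^sup>2"
proof -
  let ?P = "other_space t i" and ?\<mu> = "distr M (other_space t i) (other_samples t i)"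
  let ?Y = "\<lambda>\<omega>. (other_samples t i \<omega>, Z (Suc t) i \<omega>)"
  define \<Phi> where "\<Phi> p = ennreal ((norm (noise i (X_of t i (fst p)) (snd p)))\<^sup>2)" for p
  interpret B: prob_space "B i" by (rule prob_B)
  interpret \<mu>: prob_space ?\<mu> by (rule prob_space_distr) simp
  have [measurable]: "X_of t i \<in> borel_measurable ?P"
    using X_of_measurable by auto
  have "(\<lambda>p. ennreal ((norm ((\<lambda>(x, z). noise i x z) (X_of t i (fst p), snd p)))\<^sup>2)) \<in> borel_measurable (?P \<Otimes>\<^sub>M B i)"
    by measurable
  then have \<Phi>[measurable]: "\<Phi> \<in> borel_measurable (?P \<Otimes>\<^sub>M B i)" by (simp add: \<Phi>_def[abs_def])
  have "(\<integral>\<^sup>+\<omega>. ennreal ((norm (\<xi> t i \<omega>))\<^sup>2) \<partial>M) = (\<integral>\<^sup>+\<omega>. \<Phi> (?Y \<omega>) \<partial>M)"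
    by (simp add: \<Phi>_def \<xi>_def X_of_other_samples)
  also have "\<dots> = (\<integral>\<^sup>+p. \<Phi> p \<partial>(?\<mu> \<Otimes>\<^sub>M B i))"
    by (simp add: nn_integral_distr flip: distr_other_samples_pair)
  also have "\<dots> = (\<integral>\<^sup>+g. (\<integral>\<^sup>+z. \<Phi> (g, z) \<partial>B i) \<partial>?\<mu>)"
    by (rule B.nn_integral_fst[symmetric]) simp
  also have "\<dots> \<le> (\<integral>\<^sup>+g. ennreal (\<sigma>\<^sup>2) \<partial>?\<mu>)"
    by (rule nn_integral_mono)
      (use second_moment_integrable second_moment in
        \<open>auto simp: \<Phi>_def noise_def nn_integral_eq_integral intro!: ennreal_leI\<close>)
  also have "\<dots> = ennreal (\<sigma>\<^sup>2)" using \<mu>.emeasure_space_1 by simp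
  finally have le: "(\<integral>\<^sup>+\<omega>. ennreal ((norm (\<xi> t i \<omega>))\<^sup>2) \<partial>M) \<le> ennreal (\<sigma>\<^sup>2)" .
  then have int: "integrable M (\<lambda>\<omega>. (norm (\<xi> t i \<omega>))\<^sup>2)"
    by (intro integrableI_nonneg) (auto simp: order_le_less_trans[OF _ ennreal_less_top])
  then show "square_integrable M (\<xi> t i)" by (simp add: square_integrable_def)
  show "(\<integral>\<omega>. (norm (\<xi> t i \<omega>))\<^sup>2 \<partial>M) \<le> \<sigma>\<^sup>2"
    using le nn_integral_eq_integral[OF int] by simp
qed

lemma X_Suc: "X (Suc t) i \<omega> = (\<Sum>j\<in>UNIV. W $ i $ j *\<^sub>R X t j \<omega>) - c *\<^sub>R (F i (X t i \<omega>) + \<xi> t i \<omega>)"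
  by (simp add: X_def \<xi>_def noise_def step)

lemma X_square_integrable: "square_integrable M (X t i)"
proof (induction t arbitrary: i)
  case 0
  show ?case by (simp add: X_def square_integrable_def)
next
  case (Suc t)
  show ?case
    unfolding X_Suc[abs_def]
    by (intro square_integrable_diff square_integrable_sum square_integrable_scaleR
        square_integrable_add square_integrable_lipschitz[OF F_lipschitz] Suc \<xi>_second_moment)
qed

text \<open>For distinct agents the pair \<open>(Suc t, j)\<close> lies in
  \<open>others t i\<close>, so the noise of j is already known when the sample of i is integrated
  out.\<close>

lemma \<xi>_orthogonal:
  assumes "i \<noteq> j"
  shows "(\<integral>\<omega>. \<xi> t j \<omega> \<bullet> \<xi> t i \<omega> \<partial>M) = 0"
proof -
  define h where "h g = noise j (X_of t j g) (g (Suc t, j))" for g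
  have m: "(Suc t, j) \<in> others t i" using assms by (auto simp: others_def)
  have [measurable]: "X_of t j \<in> borel_measurable (other_space t i)" by (rule X_of_measurable) simp
  have [measurable]: "(\<lambda>g. g (Suc t, j)) \<in> measurable (other_space t i) (B j)"
    using measurable_component_singleton[OF m, of "\<lambda>(s, j). B j"] by simp
  have "(\<lambda>g. (\<lambda>(x, z). noise j x z) (X_of t j g, g (Suc t, j))) \<in> borel_measurable (other_space t i)"
    by measurable
  then have h: "h \<in> borel_measurable (other_space t i)" by (simp add: h_def[abs_def])
  have eq: "\<xi> t j \<omega> = h (other_samples t i \<omega>)" for \<omega>
    using m by (simp add: h_def \<xi>_def X_of_other_samples) (simp add: other_samples_def)
  have "integrable M (\<lambda>\<omega>. h (other_samples t i \<omega>) \<bullet> \<xi> t i \<omega>)"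
    unfolding eq[symmetric] by (intro square_integrable_inner \<xi>_second_moment)
  from noise_orthogonal[OF h this] show ?thesis by (simp add: eq)
qed

text \<open>Measurability is asked of H composed with \<open>X_of\<close> rather than of H, so that
  no sigma-algebra on families of positions has to be chosen.\<close>

lemma adapted_orthogonal:
  assumes H: "square_integrable M (\<lambda>\<omega>. H (\<lambda>j. X t j \<omega>))"
    and meas: "\<And>i. (\<lambda>g. H (\<lambda>j. X_of t j g)) \<in> borel_measurable (other_space t i)"
  shows "(\<integral>\<omega>. H (\<lambda>j. X t j \<omega>) \<bullet> avg (\<lambda>i. \<xi> t i \<omega>) \<partial>M) = 0"
proof -
  have int: "integrable M (\<lambda>\<omega>. H (\<lambda>j. X t j \<omega>) \<bullet> \<xi> t i \<omega>)" for i
    by (intro square_integrable_inner H \<xi>_second_moment)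
  have "(\<integral>\<omega>. H (\<lambda>j. X t j \<omega>) \<bullet> \<xi> t i \<omega> \<partial>M) = 0" for i
    using noise_orthogonal[OF meas[of i]] int[of i] by (simp add: X_of_other_samples)
  then show ?thesis
    by (simp add: avg_def inner_sum_right int)
qed

text \<open>In the double sum over agents only the n diagonal terms survive, against the factor 1 /
  n^2.\<close>

lemma mean_noise_second_moment:
  "(\<integral>\<omega>. (norm (avg (\<lambda>i. \<xi> t i \<omega>)))\<^sup>2 \<partial>M) \<le> \<sigma>\<^sup>2 / real CARD('n)"
proof -
  have int: "integrable M (\<lambda>\<omega>. \<xi> t i \<omega> \<bullet> \<xi> t j \<omega>)" for i j
    by (intro square_integrable_inner \<xi>_second_moment)
  have le: "(\<integral>\<omega>. \<xi> t i \<omega> \<bullet> \<xi> t j \<omega> \<partial>M) \<le> (if i = j then \<sigma>\<^sup>2 else 0)" for i j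
    using \<xi>_second_moment(2)[of t i] \<xi>_orthogonal[of j i t] by (auto simp: power2_norm_eq_inner)
  have "(\<integral>\<omega>. (norm (avg (\<lambda>i. \<xi> t i \<omega>)))\<^sup>2 \<partial>M)
      = (\<Sum>i\<in>UNIV. \<Sum>j\<in>UNIV. (\<integral>\<omega>. \<xi> t i \<omega> \<bullet> \<xi> t j \<omega> \<partial>M)) / (real CARD('n))\<^sup>2"
    unfolding power2_norm_eq_inner avg_def
    by (simp add: inner_sum_left inner_sum_right int power2_eq_square)
      (simp add: inner_commute sum_divide_distrib)
  also have "\<dots> \<le> (\<Sum>i\<in>(UNIV::'n set). \<Sum>j\<in>(UNIV::'n set). (if i = j then \<sigma>\<^sup>2 else 0)) / (real CARD('n))\<^sup>2"
    by (intro divide_right_mono sum_mono le) simp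
  also have "\<dots> = \<sigma>\<^sup>2 / real CARD('n)" by (simp add: power2_eq_square)
  finally show ?thesis .
qed

end

section \<open>Convergence rate\<close>

text \<open>The first condition in \<open>c_small\<close> makes the squared mean gradient in the
  descent step discardable; the second limits the loss of contraction to \<rho> / 2. The step size
  \<open>c\<close> may be 0, which is the case D = 0.\<close>

locale dsgd_objective = dsgd_process M W \<gamma> c loss \<theta>0 B Z F \<sigma> L
  for M :: "'w measure" and W :: "real^'n^'n" and \<gamma> c
    and loss :: "'n \<Rightarrow> real^'d \<Rightarrow> 'z \<Rightarrow> real" and \<theta>0 B Z F \<sigma> L +
  fixes U :: "real^'m^'n" and f :: "real^'d \<Rightarrow> real" and \<zeta> \<rho> :: real
  assumes W: "doubly_stochastic W"
    and U: "mat 1 - (\<chi> i j. 1 / real CARD('n)) = U ** transpose U"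
    and gap: "spectral_norm (transpose U ** W ** U) \<le> 1 - \<rho>"
    and \<rho>: "0 < \<rho>" "\<rho> \<le> 1"
    and c_nonneg: "0 \<le> c"
    and c_small: "L * c \<le> 1" "3 * (1 + 1 / \<rho>) * c\<^sup>2 * L\<^sup>2 \<le> \<rho> / 2"
    and f_differentiable: "\<And>\<theta>. f differentiable (at \<theta>)"
    and gradient_f: "\<And>\<theta>. gradient f \<theta> = avg (\<lambda>i. F i \<theta>)"
    and heterogeneity: "\<And>i \<theta>. norm (gradient f \<theta> - F i \<theta>) \<le> \<zeta>"
begin

definition Xbar :: "nat \<Rightarrow> 'w \<Rightarrow> real^'d" where
  "Xbar t \<omega> = avg (\<lambda>i. X t i \<omega>)"

definition gbar :: "nat \<Rightarrow> 'w \<Rightarrow> real^'d" where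
  "gbar t \<omega> = avg (\<lambda>i. F i (X t i \<omega>))"

definition \<xi>bar :: "nat \<Rightarrow> 'w \<Rightarrow> real^'d" where
  "\<xi>bar t \<omega> = avg (\<lambda>i. \<xi> t i \<omega>)"

definition S :: "nat \<Rightarrow> 'w \<Rightarrow> real" where
  "S t \<omega> = (\<Sum>i\<in>UNIV. (norm (X t i \<omega> - Xbar t \<omega>))\<^sup>2)"

lemma L_nonneg: "0 \<le> L"
  by (rule lipschitz_constant_nonneg[OF F_lipschitz])

lemma gradient_f_lipschitz: "norm (gradient f y - gradient f x) \<le> L * norm (y - x)"
proof -
  have "(norm (gradient f y - gradient f x))\<^sup>2 = (norm (avg (\<lambda>i. F i y - F i x)))\<^sup>2"
    by (simp add: gradient_f avg_linear)
  also have "\<dots> \<le> (\<Sum>i\<in>(UNIV::'n set). (norm (F i y - F i x))\<^sup>2) / real CARD('n)"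
    by (rule norm_avg_power2_le)
  also have "\<dots> \<le> (\<Sum>i\<in>(UNIV::'n set). (L * norm (y - x))\<^sup>2) / real CARD('n)"
    by (intro divide_right_mono sum_mono power_mono F_lipschitz) auto
  also have "\<dots> = (L * norm (y - x))\<^sup>2" by simp
  finally show ?thesis by (rule power2_le_imp_le) (simp add: L_nonneg)
qed

lemma Xbar_Suc: "Xbar (Suc t) \<omega> = Xbar t \<omega> - c *\<^sub>R (gbar t \<omega> + \<xi>bar t \<omega>)"
  by (simp add: Xbar_def gbar_def \<xi>bar_def X_Suc avg_linear avg_mixing[OF W])

lemma gradient_bias: "(norm (gradient f (Xbar t \<omega>) - gbar t \<omega>))\<^sup>2 \<le> L\<^sup>2 / real CARD('n) * S t \<omega>"
proof -
  have "(norm (gradient f (Xbar t \<omega>) - gbar t \<omega>))\<^sup>2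
      = (norm (avg (\<lambda>i. F i (Xbar t \<omega>) - F i (X t i \<omega>))))\<^sup>2"
    by (simp add: gradient_f gbar_def avg_linear)
  also have "\<dots> \<le> (\<Sum>i\<in>UNIV. (norm (F i (Xbar t \<omega>) - F i (X t i \<omega>)))\<^sup>2) / real CARD('n)"
    by (rule norm_avg_power2_le)
  also have "\<dots> \<le> (\<Sum>i\<in>UNIV. (L * norm (X t i \<omega> - Xbar t \<omega>))\<^sup>2) / real CARD('n)"
    by (intro divide_right_mono sum_mono power_mono) (auto simp: norm_minus_commute F_lipschitz)
  also have "\<dots> = L\<^sup>2 / real CARD('n) * S t \<omega>"
    by (simp add: S_def power_mult_distrib sum_distrib_left sum_divide_distrib)
  finally show ?thesis .
qed

lemma descent_step:
  "c / 2 * (norm (gradient f (Xbar t \<omega>)))\<^sup>2 \<le> f (Xbar t \<omega>) - f (Xbar (Suc t) \<omega>)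
    + c / 2 * (L\<^sup>2 / real CARD('n) * S t \<omega>)
    + (L * c\<^sup>2 * (gbar t \<omega> \<bullet> \<xi>bar t \<omega>) - c * (gradient f (Xbar t \<omega>) \<bullet> \<xi>bar t \<omega>))
    + L * c\<^sup>2 / 2 * (norm (\<xi>bar t \<omega>))\<^sup>2"
proof -
  let ?a = "gradient f (Xbar t \<omega>)" and ?m = "gbar t \<omega>" and ?e = "\<xi>bar t \<omega>"
  have "f (Xbar t \<omega> + - (c *\<^sub>R (?m + ?e)))
      \<le> f (Xbar t \<omega>) + - (c *\<^sub>R (?m + ?e)) \<bullet> ?a + L / 2 * (norm (- (c *\<^sub>R (?m + ?e))))\<^sup>2"
    by (rule descent_lemma[OF f_differentiable gradient_f_lipschitz])
  moreover have "(norm (- (c *\<^sub>R (?m + ?e))))\<^sup>2 = c\<^sup>2 * (norm (?m + ?e))\<^sup>2"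
    by (simp only: norm_minus_cancel norm_scaleR power_mult_distrib power2_abs)
  ultimately have "f (Xbar (Suc t) \<omega>) \<le> f (Xbar t \<omega>) - c * (?a \<bullet> ?m) - c * (?a \<bullet> ?e)
      + L / 2 * c\<^sup>2 * (norm (?m + ?e))\<^sup>2"
    by (simp add: Xbar_Suc inner_simps inner_commute distrib_left del: scaleR_right_distrib)
  also have "(norm (?m + ?e))\<^sup>2 = (norm ?m)\<^sup>2 + 2 * (?m \<bullet> ?e) + (norm ?e)\<^sup>2"
    by (simp add: power2_norm_eq_inner inner_simps inner_commute)
  \<comment> \<open>Polarization: the squared gradient appears with the sign needed, the bias |a -
    m| is controlled by the consensus error, and the |m|^2 terms combine to the factor L c -
    1.\<close>
  also have "?a \<bullet> ?m = ((norm ?a)\<^sup>2 + (norm ?m)\<^sup>2 - (norm (?a - ?m))\<^sup>2) / 2"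
    by (simp add: power2_norm_eq_inner inner_simps inner_commute)
  finally have "c / 2 * (norm ?a)\<^sup>2 \<le> f (Xbar t \<omega>) - f (Xbar (Suc t) \<omega>)
      + c / 2 * (norm (?a - ?m))\<^sup>2 + (L * c\<^sup>2 * (?m \<bullet> ?e) - c * (?a \<bullet> ?e))
      + L * c\<^sup>2 / 2 * (norm ?e)\<^sup>2 + (L * c - 1) * (c / 2 * (norm ?m)\<^sup>2)"
    by (simp add: field_simps power2_eq_square)
  moreover have "(L * c - 1) * (c / 2 * (norm ?m)\<^sup>2) \<le> 0"
    using c_small c_nonneg by (intro mult_nonpos_nonneg) auto
  moreover have "c / 2 * (norm (?a - ?m))\<^sup>2 \<le> c / 2 * (L\<^sup>2 / real CARD('n) * S t \<omega>)"
    using gradient_bias c_nonneg by (intro mult_left_mono) auto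
  ultimately show ?thesis by linarith
qed

text \<open>Per unit of c^2, the expected consensus error injected in one step: the factor 3 comes
  from a three-way split of the gradient, 1 + 1 / \<rho> from Young's inequality.\<close>

definition K :: real where
  "K = 3 * (1 + 1 / \<rho>) * (real CARD('n) * (\<sigma>\<^sup>2 + \<zeta>\<^sup>2))"

text \<open>The new deviations are the mixed old ones \<open>w\<close>, which contract, plus the
  centered gradient step \<open>u\<close>, which is of order c.\<close>

lemma consensus_step:
  "S (Suc t) \<omega> \<le> (1 - \<rho> / 2) * S t \<omega>
    + 3 * (1 + 1 / \<rho>) * c\<^sup>2 * ((\<Sum>i\<in>UNIV. (norm (\<xi> t i \<omega>))\<^sup>2) + real CARD('n) * \<zeta>\<^sup>2)"
proof -
  let ?x = "\<lambda>i. X t i \<omega>" and ?b = "Xbar t \<omega>" and ?N = "\<Sum>i\<in>UNIV. (norm (\<xi> t i \<omega>))\<^sup>2"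
  define g where "g i = F i (?x i) + \<xi> t i \<omega>" for i
  define v where "v i = ?x i - ?b" for i
  define w where "w i = (\<Sum>j\<in>UNIV. W $ i $ j *\<^sub>R v j)" for i
  define u where "u i = - (c *\<^sub>R (g i - avg g))" for i
  have S: "S t \<omega> = (\<Sum>i\<in>UNIV. (norm (v i))\<^sup>2)" by (simp add: S_def v_def)
  have "(\<Sum>i\<in>UNIV. v i) = 0"
    unfolding v_def Xbar_def by (rule sum_deviation_avg)
  then have w: "(\<Sum>i\<in>UNIV. (norm (w i))\<^sup>2) \<le> (1 - \<rho>)\<^sup>2 * S t \<omega>"
    unfolding w_def S by (rule mixing_contraction_family[OF W U gap])
  have "X (Suc t) i \<omega> - Xbar (Suc t) \<omega> = w i + u i" for i
  proof -
    have "avg g = gbar t \<omega> + \<xi>bar t \<omega>"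
      by (simp add: g_def[abs_def] gbar_def \<xi>bar_def avg_linear)
    then show ?thesis
      by (simp add: X_Suc Xbar_Suc w_def u_def v_def g_def mixing_const[OF W]
          scaleR_diff_right sum_subtractf algebra_simps)
  qed
  then have "S (Suc t) \<omega> = (\<Sum>i\<in>UNIV. (norm (w i + u i))\<^sup>2)" by (simp add: S_def)
  \<comment> \<open>The weight \<rho> costs one factor of the contraction: (1 + \<rho>) (1 -
    \<rho>)^2 = (1 - \<rho>) (1 - \<rho>^2), which is at most 1 - \<rho>.\<close>
  also have "\<dots> \<le> (\<Sum>i\<in>UNIV. (1 + \<rho>) * (norm (w i))\<^sup>2 + (1 + 1 / \<rho>) * (norm (u i))\<^sup>2)"
    by (intro sum_mono power2_norm_add_le \<rho>)
  also have "\<dots> = (1 + \<rho>) * (\<Sum>i\<in>UNIV. (norm (w i))\<^sup>2) + (1 + 1 / \<rho>) * c\<^sup>2 * (\<Sum>i\<in>UNIV. (norm (g i - avg g))\<^sup>2)"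
    by (simp add: sum.distrib u_def power_mult_distrib mult.assoc flip: sum_distrib_left)
  also have "\<dots> \<le> (1 - \<rho>) * S t \<omega> + (1 + 1 / \<rho>) * c\<^sup>2 * (3 * (?N + L\<^sup>2 * S t \<omega> + real CARD('n) * \<zeta>\<^sup>2))"
  proof (intro add_mono mult_left_mono)
    have "(1 + \<rho>) * (\<Sum>i\<in>UNIV. (norm (w i))\<^sup>2) \<le> (1 + \<rho>) * ((1 - \<rho>)\<^sup>2 * S t \<omega>)"
      using w \<rho> by (intro mult_left_mono) auto
    also have "\<dots> = ((1 - \<rho>) * S t \<omega>) * (1 - \<rho>\<^sup>2)" by (simp add: power2_eq_square algebra_simps)
    also have "\<dots> \<le> (1 - \<rho>) * S t \<omega>"
      using \<rho> by (intro mult_right_le_one_le) (auto simp: S sum_nonneg power_le_one)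
    finally show "(1 + \<rho>) * (\<Sum>i\<in>UNIV. (norm (w i))\<^sup>2) \<le> (1 - \<rho>) * S t \<omega>" .
    \<comment> \<open>Recentered at \<open>gradient f ?b\<close>, each term splits into noise, a
      Lipschitz error from \<open>?x i\<close> to \<open>?b\<close>, and heterogeneity at
      \<open>?b\<close>.\<close>
    have "(\<Sum>i\<in>UNIV. (norm (g i - avg g))\<^sup>2) \<le> (\<Sum>i\<in>UNIV. (norm (g i - gradient f ?b))\<^sup>2)"
      by (rule sum_deviation_power2_le)
    also have "\<dots> \<le> (\<Sum>i\<in>UNIV. 3 * ((norm (\<xi> t i \<omega>))\<^sup>2 + (L * norm (v i))\<^sup>2 + \<zeta>\<^sup>2))"
    proof (rule sum_mono)
      fix i
      have "(norm (g i - gradient f ?b))\<^sup>2 = (norm (\<xi> t i \<omega> + (F i (?x i) - F i ?b) + (F i ?b - gradient f ?b)))\<^sup>2"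
        by (simp add: g_def algebra_simps)
      also have "\<dots> \<le> 3 * ((norm (\<xi> t i \<omega>))\<^sup>2 + (norm (F i (?x i) - F i ?b))\<^sup>2 + (norm (F i ?b - gradient f ?b))\<^sup>2)"
        by (rule power2_norm_add3_le)
      also have "\<dots> \<le> 3 * ((norm (\<xi> t i \<omega>))\<^sup>2 + (L * norm (v i))\<^sup>2 + \<zeta>\<^sup>2)"
        using heterogeneity[of ?b i] unfolding v_def
        by (intro mult_left_mono add_mono power_mono F_lipschitz) (auto simp: norm_minus_commute)
      finally show "(norm (g i - gradient f ?b))\<^sup>2 \<le> 3 * ((norm (\<xi> t i \<omega>))\<^sup>2 + (L * norm (v i))\<^sup>2 + \<zeta>\<^sup>2)" .
    qed
    also have "\<dots> = 3 * (?N + L\<^sup>2 * S t \<omega> + real CARD('n) * \<zeta>\<^sup>2)"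
      by (simp add: S sum.distrib power_mult_distrib flip: sum_distrib_left)
    finally show "(\<Sum>i\<in>UNIV. (norm (g i - avg g))\<^sup>2) \<le> 3 * (?N + L\<^sup>2 * S t \<omega> + real CARD('n) * \<zeta>\<^sup>2)" .
  qed (use \<rho> in simp)
  also have "\<dots> = (1 - \<rho>) * S t \<omega> + (3 * (1 + 1 / \<rho>) * c\<^sup>2 * L\<^sup>2) * S t \<omega>
      + 3 * (1 + 1 / \<rho>) * c\<^sup>2 * (?N + real CARD('n) * \<zeta>\<^sup>2)"
    by (simp add: distrib_left distrib_right ac_simps)
  also have "(3 * (1 + 1 / \<rho>) * c\<^sup>2 * L\<^sup>2) * S t \<omega> \<le> \<rho> / 2 * S t \<omega>"
    using c_small by (intro mult_right_mono) (auto simp: S sum_nonneg)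
  finally show ?thesis by (simp add: left_diff_distrib)
qed

section \<open>Integrability, vanishing cross terms and summation over time\<close>

lemma Xbar_square_integrable: "square_integrable M (Xbar t)"
  unfolding Xbar_def[abs_def] by (intro square_integrable_avg X_square_integrable)

lemma gradient_square_integrable: "square_integrable M (\<lambda>\<omega>. gradient f (Xbar t \<omega>))"
  by (intro square_integrable_lipschitz[OF gradient_f_lipschitz] Xbar_square_integrable)

lemma gbar_square_integrable: "square_integrable M (gbar t)"
  unfolding gbar_def[abs_def]
  by (intro square_integrable_avg square_integrable_lipschitz[OF F_lipschitz] X_square_integrable)

lemma \<xi>bar_square_integrable: "square_integrable M (\<xi>bar t)"
  unfolding \<xi>bar_def[abs_def] by (intro square_integrable_avg \<xi>_second_moment)

lemma S_integrable: "integrable M (S t)"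
proof -
  have "square_integrable M (\<lambda>\<omega>. X t i \<omega> - Xbar t \<omega>)" for i
    by (intro square_integrable_diff X_square_integrable Xbar_square_integrable)
  then show ?thesis unfolding S_def[abs_def] by (auto simp: square_integrable_def)
qed

lemma S_nonneg: "0 \<le> S t \<omega>" by (simp add: S_def sum_nonneg)

lemma gradient_f_measurable[measurable]: "gradient f \<in> borel_measurable borel"
  unfolding gradient_f[abs_def] avg_def by measurable

lemma gradient_noise_orthogonal: "(\<integral>\<omega>. gradient f (Xbar t \<omega>) \<bullet> \<xi>bar t \<omega> \<partial>M) = 0"
proof -
  have "(\<lambda>g. gradient f (avg (\<lambda>j. X_of t j g))) \<in> borel_measurable (other_space t i)" for i
    unfolding avg_def using X_of_measurable[of t t _ i] by measurable
  then show ?thesis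
    using adapted_orthogonal[of "\<lambda>x. gradient f (avg x)" t] gradient_square_integrable
    by (simp add: Xbar_def \<xi>bar_def)
qed

lemma gbar_noise_orthogonal: "(\<integral>\<omega>. gbar t \<omega> \<bullet> \<xi>bar t \<omega> \<partial>M) = 0"
proof -
  have "(\<lambda>g. avg (\<lambda>j. F j (X_of t j g))) \<in> borel_measurable (other_space t i)" for i
    unfolding avg_def using X_of_measurable[of t t _ i] by measurable
  then show ?thesis
    using adapted_orthogonal[of "\<lambda>x. avg (\<lambda>j. F j (x j))" t] gbar_square_integrable
    by (simp add: gbar_def[abs_def] \<xi>bar_def)
qed

text \<open>Instead of unrolling the recursion into a geometric sum, it is read as a bound of \<rho>
  / 2 times the error by its decrease plus \<open>c\<^sup>2 * K\<close>, which telescopes.\<close>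

lemma consensus_sum:
  "(\<Sum>t<T. \<integral>\<omega>. S t \<omega> \<partial>M) \<le> 2 / \<rho> * ((\<Sum>i\<in>UNIV. (norm (\<theta>0 i - avg \<theta>0))\<^sup>2) + real T * (c\<^sup>2 * K))"
proof -
  have step: "(\<integral>\<omega>. S (Suc t) \<omega> \<partial>M) \<le> (1 - \<rho> / 2) * (\<integral>\<omega>. S t \<omega> \<partial>M) + c\<^sup>2 * K" for t
  proof -
    have int: "integrable M (\<lambda>\<omega>. (norm (\<xi> t i \<omega>))\<^sup>2)" for i
      using \<xi>_second_moment(1) by (simp add: square_integrable_def)
    have "(\<integral>\<omega>. S (Suc t) \<omega> \<partial>M) \<le> (\<integral>\<omega>. (1 - \<rho> / 2) * S t \<omega>
        + 3 * (1 + 1 / \<rho>) * c\<^sup>2 * ((\<Sum>i\<in>UNIV. (norm (\<xi> t i \<omega>))\<^sup>2) + real CARD('n) * \<zeta>\<^sup>2) \<partial>M)"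
      by (intro integral_mono consensus_step Bochner_Integration.integrable_add
          integrable_mult_right Bochner_Integration.integrable_sum S_integrable int) simp
    also have "\<dots> = (1 - \<rho> / 2) * (\<integral>\<omega>. S t \<omega> \<partial>M) + 3 * (1 + 1 / \<rho>) * c\<^sup>2
        * ((\<Sum>i\<in>UNIV. \<integral>\<omega>. (norm (\<xi> t i \<omega>))\<^sup>2 \<partial>M) + real CARD('n) * \<zeta>\<^sup>2)"
      by (simp add: S_integrable int prob_space)
    also have "\<dots> \<le> (1 - \<rho> / 2) * (\<integral>\<omega>. S t \<omega> \<partial>M) + 3 * (1 + 1 / \<rho>) * c\<^sup>2
        * ((\<Sum>i\<in>(UNIV::'n set). \<sigma>\<^sup>2) + real CARD('n) * \<zeta>\<^sup>2)"
      using \<rho> by (intro add_left_mono mult_left_mono add_right_mono sum_mono \<xi>_second_moment) auto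
    also have "\<dots> = (1 - \<rho> / 2) * (\<integral>\<omega>. S t \<omega> \<partial>M) + c\<^sup>2 * K"
      by (simp add: K_def distrib_left mult_ac)
    finally show ?thesis .
  qed
  have "(\<Sum>t<T. \<rho> / 2 * (\<integral>\<omega>. S t \<omega> \<partial>M)) \<le> (\<Sum>t<T. (\<integral>\<omega>. S t \<omega> \<partial>M) - (\<integral>\<omega>. S (Suc t) \<omega> \<partial>M) + c\<^sup>2 * K)"
  proof (rule sum_mono)
    fix t show "\<rho> / 2 * (\<integral>\<omega>. S t \<omega> \<partial>M) \<le> (\<integral>\<omega>. S t \<omega> \<partial>M) - (\<integral>\<omega>. S (Suc t) \<omega> \<partial>M) + c\<^sup>2 * K"
      using step[of t] by (simp add: algebra_simps)
  qed
  also have "\<dots> = (\<integral>\<omega>. S 0 \<omega> \<partial>M) - (\<integral>\<omega>. S T \<omega> \<partial>M) + real T * (c\<^sup>2 * K)"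
    by (simp add: sum.distrib sum_lessThan_telescope'[of "\<lambda>t. \<integral>\<omega>. S t \<omega> \<partial>M"])
  also have "\<dots> \<le> (\<integral>\<omega>. S 0 \<omega> \<partial>M) + real T * (c\<^sup>2 * K)"
    by (simp add: S_nonneg)
  also have "(\<integral>\<omega>. S 0 \<omega> \<partial>M) = (\<Sum>i\<in>UNIV. (norm (\<theta>0 i - avg \<theta>0))\<^sup>2)"
    by (simp add: S_def X_def Xbar_def prob_space)
  finally have "\<rho> / 2 * (\<Sum>t<T. \<integral>\<omega>. S t \<omega> \<partial>M) \<le> (\<Sum>i\<in>UNIV. (norm (\<theta>0 i - avg \<theta>0))\<^sup>2) + real T * (c\<^sup>2 * K)"
    by (simp only: sum_distrib_left)
  then show ?thesis using \<rho> by (simp add: field_simps)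
qed

lemma gradient_sum:
  assumes fs: "\<And>x. fs \<le> f x"
  shows "c * (\<Sum>t<T. \<integral>\<omega>. (norm (gradient f (Xbar t \<omega>)))\<^sup>2 \<partial>M) \<le> 2 * (f (avg \<theta>0) - fs)
    + real T * (L * c\<^sup>2 * \<sigma>\<^sup>2 / real CARD('n))
    + c * L\<^sup>2 / real CARD('n) * (2 / \<rho> * ((\<Sum>i\<in>UNIV. (norm (\<theta>0 i - avg \<theta>0))\<^sup>2) + real T * (c\<^sup>2 * K)))"
proof -
  let ?n = "real CARD('n)"
  define A where "A t \<omega> = c / 2 * (L\<^sup>2 / ?n * S t \<omega>)
    + (L * c\<^sup>2 * (gbar t \<omega> \<bullet> \<xi>bar t \<omega>) - c * (gradient f (Xbar t \<omega>) \<bullet> \<xi>bar t \<omega>))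
    + L * c\<^sup>2 / 2 * (norm (\<xi>bar t \<omega>))\<^sup>2" for t \<omega>
  have int: "integrable M (\<lambda>\<omega>. gbar t \<omega> \<bullet> \<xi>bar t \<omega>)" "integrable M (\<lambda>\<omega>. gradient f (Xbar t \<omega>) \<bullet> \<xi>bar t \<omega>)"
    "integrable M (\<lambda>\<omega>. (norm (\<xi>bar t \<omega>))\<^sup>2)" "integrable M (\<lambda>\<omega>. (norm (gradient f (Xbar t \<omega>)))\<^sup>2)" for t
    using \<xi>bar_square_integrable gradient_square_integrable
    by (auto simp: square_integrable_def intro!: square_integrable_inner
        gbar_square_integrable \<xi>bar_square_integrable gradient_square_integrable)
  have A_int: "integrable M (A t)" for t
    unfolding A_def[abs_def] by (intro Bochner_Integration.integrable_add
      Bochner_Integration.integrable_diff integrable_mult_right S_integrable int)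
  have A_le: "(\<integral>\<omega>. A t \<omega> \<partial>M) \<le> c / 2 * (L\<^sup>2 / ?n * (\<integral>\<omega>. S t \<omega> \<partial>M)) + L * c\<^sup>2 / 2 * (\<sigma>\<^sup>2 / ?n)" for t
  proof -
    have "(\<integral>\<omega>. A t \<omega> \<partial>M) = c / 2 * (L\<^sup>2 / ?n * (\<integral>\<omega>. S t \<omega> \<partial>M)) + L * c\<^sup>2 / 2 * (\<integral>\<omega>. (norm (\<xi>bar t \<omega>))\<^sup>2 \<partial>M)"
      by (simp add: A_def int S_integrable gradient_noise_orthogonal gbar_noise_orthogonal)
    moreover have "L * c\<^sup>2 / 2 * (\<integral>\<omega>. (norm (\<xi>bar t \<omega>))\<^sup>2 \<partial>M) \<le> L * c\<^sup>2 / 2 * (\<sigma>\<^sup>2 / ?n)"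
      unfolding \<xi>bar_def using L_nonneg by (intro mult_left_mono mean_noise_second_moment) simp
    ultimately show ?thesis by simp
  qed
  \<comment> \<open>Summing pathwise before integrating leaves only the deterministic initial value
    of f and the lower bound \<open>fs\<close>, so integrability of f at the iterates is never at
    issue.\<close>
  have pw: "(\<Sum>t<T. c / 2 * (norm (gradient f (Xbar t \<omega>)))\<^sup>2) \<le> f (avg \<theta>0) - fs + (\<Sum>t<T. A t \<omega>)" for \<omega>
  proof -
    have "(\<Sum>t<T. c / 2 * (norm (gradient f (Xbar t \<omega>)))\<^sup>2)
        \<le> (\<Sum>t<T. (f (Xbar t \<omega>) - f (Xbar (Suc t) \<omega>)) + A t \<omega>)"
      using descent_step by (intro sum_mono) (simp add: A_def add.assoc)
    also have "\<dots> = f (Xbar 0 \<omega>) - f (Xbar T \<omega>) + (\<Sum>t<T. A t \<omega>)"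
      by (simp add: sum.distrib sum_lessThan_telescope'[of "\<lambda>t. f (Xbar t \<omega>)"])
    also have "\<dots> \<le> f (avg \<theta>0) - fs + (\<Sum>t<T. A t \<omega>)"
      using fs[of "Xbar T \<omega>"] by (simp add: Xbar_def X_def)
    finally show ?thesis .
  qed
  have "c / 2 * (\<Sum>t<T. \<integral>\<omega>. (norm (gradient f (Xbar t \<omega>)))\<^sup>2 \<partial>M)
      = (\<integral>\<omega>. (\<Sum>t<T. c / 2 * (norm (gradient f (Xbar t \<omega>)))\<^sup>2) \<partial>M)"
    by (simp add: int sum_distrib_left)
  also have "\<dots> \<le> (\<integral>\<omega>. f (avg \<theta>0) - fs + (\<Sum>t<T. A t \<omega>) \<partial>M)"
    by (intro integral_mono pw Bochner_Integration.integrable_add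
        Bochner_Integration.integrable_sum integrable_mult_right int A_int) simp
  also have "\<dots> = f (avg \<theta>0) - fs + (\<Sum>t<T. \<integral>\<omega>. A t \<omega> \<partial>M)"
    by (simp add: A_int prob_space)
  also have "\<dots> \<le> f (avg \<theta>0) - fs
      + (\<Sum>t<T. c / 2 * (L\<^sup>2 / ?n * (\<integral>\<omega>. S t \<omega> \<partial>M)) + L * c\<^sup>2 / 2 * (\<sigma>\<^sup>2 / ?n))"
    by (intro add_left_mono sum_mono A_le)
  also have "\<dots> = f (avg \<theta>0) - fs + c / 2 * (L\<^sup>2 / ?n * (\<Sum>t<T. \<integral>\<omega>. S t \<omega> \<partial>M))
      + real T * (L * c\<^sup>2 / 2 * (\<sigma>\<^sup>2 / ?n))"
    by (simp add: sum.distrib sum_distrib_left)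
  also have "\<dots> \<le> f (avg \<theta>0) - fs
      + c / 2 * (L\<^sup>2 / ?n * (2 / \<rho> * ((\<Sum>i\<in>UNIV. (norm (\<theta>0 i - avg \<theta>0))\<^sup>2) + real T * (c\<^sup>2 * K))))
      + real T * (L * c\<^sup>2 / 2 * (\<sigma>\<^sup>2 / ?n))"
    using c_nonneg by (intro add_left_mono add_right_mono mult_left_mono consensus_sum) auto
  also have "\<dots> = (2 * (f (avg \<theta>0) - fs) + real T * (L * c\<^sup>2 * \<sigma>\<^sup>2 / ?n)
      + c * L\<^sup>2 / ?n * (2 / \<rho> * ((\<Sum>i\<in>UNIV. (norm (\<theta>0 i - avg \<theta>0))\<^sup>2) + real T * (c\<^sup>2 * K)))) / 2"
    by (simp add: add_divide_distrib diff_divide_distrib mult_ac)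
  finally show ?thesis by simp
qed

text \<open>The random iterate is decomposed over the events that the index equals t. Each indicator
  is independent of the gradient at time t, so expectations factor and every t < T gets weight 1 /
  T.\<close>

lemma random_index_expectation:
  assumes \<tau>: "uniform_random_index M (sample_events M B Z) T \<tau>" and T: "1 \<le> T"
  shows "integrable M (\<lambda>\<omega>. (norm (gradient f (Xbar (\<tau> \<omega>) \<omega>)))\<^sup>2)"
    and "(\<integral>\<omega>. (norm (gradient f (Xbar (\<tau> \<omega>) \<omega>)))\<^sup>2 \<partial>M)
      = (\<Sum>t<T. \<integral>\<omega>. (norm (gradient f (Xbar t \<omega>)))\<^sup>2 \<partial>M) / real T"
proof -
  let ?q = "\<lambda>t \<omega>. (norm (gradient f (Xbar t \<omega>)))\<^sup>2"
  let ?G = "{Z t i -` A \<inter> space M | t i A. 1 \<le> t \<and> A \<in> sets (B i)}"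
  \<comment> \<open>Turns \<open>sample_events\<close> into a measurable space, so that the
    gradients along the path are seen to be measurable with respect to the samples alone.\<close>
  define N where "N = sigma (space M) ?G"
  have \<tau>_meas[measurable]: "\<tau> \<in> measurable M (count_space UNIV)"
    and \<tau>_distr: "distr M (count_space UNIV) \<tau> = measure_pmf (pmf_of_set {0..<T})"
    and \<tau>_indep: "indep_set {\<tau> -` A \<inter> space M | A. A \<subseteq> UNIV} (sample_events M B Z)"
    using \<tau> by (auto simp: uniform_random_index_def)
  have sets_N: "sets N = sample_events M B Z" "space N = space M"
    unfolding N_def sample_events_def by (intro sets_measure_of space_measure_of; blast)+
  have Z_N: "Z t i \<in> measurable N (B i)" if "1 \<le> t" for t i
  proof (rule measurableI)
    show "Z t i \<omega> \<in> space (B i)" if "\<omega> \<in> space N" for \<omega>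
      using measurable_space[OF Z_measurable'[OF \<open>1 \<le> t\<close>]] that unfolding sets_N .
    show "Z t i -` A \<inter> space N \<in> sets N" if "A \<in> sets (B i)" for A
      unfolding sets_N sample_events_def using that \<open>1 \<le> t\<close> by (intro sigma_sets.Basic) auto
  qed
  have [measurable]: "X t i \<in> borel_measurable N" for t i
    unfolding X_def by (rule borel_measurable_dsgd[OF loss_differentiable loss_measurable Z_N])
  have q_meas: "?q t \<in> borel_measurable N" for t
    unfolding Xbar_def avg_def by measurable
  have q_int: "integrable M (?q t)" for t
    using gradient_square_integrable by (simp add: square_integrable_def)
  have ind_meas: "(\<lambda>\<omega>. indicator {t} (\<tau> \<omega>) :: real) \<in> borel_measurable M" for t
    by (rule measurable_compose[OF \<tau>_meas]) simp
  have ind: "indep_var borel (\<lambda>\<omega>. indicator {t} (\<tau> \<omega>) :: real) borel (?q t)" for t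
    unfolding indep_var_eq
  proof (intro conjI)
    have "sigma_sets (space M) {(\<lambda>\<omega>. indicator {t} (\<tau> \<omega>) :: real) -` A \<inter> space M | A. A \<in> sets borel}
        \<subseteq> {\<tau> -` A \<inter> space M | A. A \<subseteq> UNIV}"
    proof -
      \<comment> \<open>The preimages under \<open>\<tau>\<close> already form a sigma-algebra, so
        generating from the indicator adds nothing outside them.\<close>
      let ?V = "vimage_algebra (space M) \<tau> (count_space UNIV)"
      have V: "sets ?V = {\<tau> -` A \<inter> space M | A. A \<subseteq> UNIV}"
        by (subst sets_vimage_algebra2) auto
      have "{(\<lambda>\<omega>. indicator {t} (\<tau> \<omega>) :: real) -` A \<inter> space M | A. A \<in> sets borel} \<subseteq> sets ?V"
      proof safe
        fix A :: "real set"
        have "(\<lambda>\<omega>. indicator {t} (\<tau> \<omega>) :: real) -` A \<inter> space M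
            = \<tau> -` ((\<lambda>k. indicator {t} k :: real) -` A) \<inter> space M" by auto
        then show "(\<lambda>\<omega>. indicator {t} (\<tau> \<omega>) :: real) -` A \<inter> space M \<in> sets ?V"
          unfolding V by blast
      qed
      from sets.sigma_sets_subset[OF this] show ?thesis by (simp add: V)
    qed
    moreover have "sigma_sets (space M) {?q t -` A \<inter> space M | A. A \<in> sets borel} \<subseteq> sample_events M B Z"
    proof -
      have "{?q t -` A \<inter> space M | A. A \<in> sets borel} \<subseteq> sets N"
        using measurable_sets[OF q_meas[of t]] by (auto simp: sets_N)
      then show ?thesis using sets.sigma_sets_subset[of _ N] by (simp add: sets_N)
    qed
    ultimately show "indep_set
        (sigma_sets (space M) {(\<lambda>\<omega>. indicator {t} (\<tau> \<omega>) :: real) -` A \<inter> space M | A. A \<in> sets borel})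
        (sigma_sets (space M) {?q t -` A \<inter> space M | A. A \<in> sets borel})"
      using \<tau>_indep unfolding indep_set_def
      by (elim indep_sets_mono_sets) (auto split: bool.split)
  qed (use q_int[of t] ind_meas[of t] in auto)
  have ind_int: "integrable M (\<lambda>\<omega>. indicator {t} (\<tau> \<omega>) :: real)" for t
    by (rule integrable_const_bound[OF _ ind_meas, of _ 1]) (auto simp: indicator_def)
  have prob_\<tau>: "(\<integral>\<omega>. indicator {t} (\<tau> \<omega>) \<partial>M) = 1 / real T" if "t < T" for t
  proof -
    have "(\<integral>\<omega>. indicator {t} (\<tau> \<omega>) \<partial>M) = (\<integral>k. (indicator {t} k :: real) \<partial>distr M (count_space UNIV) \<tau>)"
      by (subst integral_distr) auto
    also have "\<dots> = 1 / real T"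
      unfolding \<tau>_distr using that by (simp add: pmf_of_set measure_pmf_single)
    finally show ?thesis .
  qed
  \<comment> \<open>Only the law of the index is given, so it may leave {0..<T} on a null set and
    the decomposition holds almost everywhere.\<close>
  have "AE k in distr M (count_space UNIV) \<tau>. k < T"
    unfolding \<tau>_distr using T by (auto simp: AE_measure_pmf_iff set_pmf_of_set)
  then have "AE \<omega> in M. \<tau> \<omega> < T" by (simp add: AE_distr_iff)
  then have AE: "AE \<omega> in M. ?q (\<tau> \<omega>) \<omega> = (\<Sum>t<T. indicator {t} (\<tau> \<omega>) * ?q t \<omega>)"
  proof (rule AE_mp, intro AE_I2 impI)
    fix \<omega> assume "\<tau> \<omega> < T"
    then show "?q (\<tau> \<omega>) \<omega> = (\<Sum>t<T. indicator {t} (\<tau> \<omega>) * ?q t \<omega>)"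
      by (subst sum.remove[of _ "\<tau> \<omega>"]) (auto simp: indicator_def)
  qed
  have [measurable]: "?q t \<in> borel_measurable M" for t using q_int[of t] by simp
  have meas: "(\<lambda>\<omega>. ?q (\<tau> \<omega>) \<omega>) \<in> borel_measurable M"
    by (rule measurable_compose_countable) auto
  have prod_int: "integrable M (\<lambda>\<omega>. indicator {t} (\<tau> \<omega>) * ?q t \<omega>)" for t
    by (rule indep_var_integrable[OF ind ind_int q_int])
  show "integrable M (\<lambda>\<omega>. ?q (\<tau> \<omega>) \<omega>)"
  proof (rule integrable_cong_AE_imp[OF _ meas])
    show "integrable M (\<lambda>\<omega>. \<Sum>t<T. indicator {t} (\<tau> \<omega>) * ?q t \<omega>)"
      by (intro Bochner_Integration.integrable_sum prod_int)
    show "AE \<omega> in M. (\<Sum>t<T. indicator {t} (\<tau> \<omega>) * ?q t \<omega>) = ?q (\<tau> \<omega>) \<omega>"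
      using AE by eventually_elim (rule sym)
  qed
  have "(\<integral>\<omega>. ?q (\<tau> \<omega>) \<omega> \<partial>M) = (\<integral>\<omega>. (\<Sum>t<T. indicator {t} (\<tau> \<omega>) * ?q t \<omega>) \<partial>M)"
    by (rule integral_cong_AE[OF meas _ AE]) (intro borel_measurable_sum borel_measurable_integrable[OF prod_int])
  also have "\<dots> = (\<Sum>t<T. (\<integral>\<omega>. indicator {t} (\<tau> \<omega>) \<partial>M) * (\<integral>\<omega>. ?q t \<omega> \<partial>M))"
    by (subst Bochner_Integration.integral_sum[OF prod_int]) (simp only: indep_var_lebesgue_integral[OF ind ind_int q_int])
  also have "\<dots> = (\<Sum>t<T. \<integral>\<omega>. ?q t \<omega> \<partial>M) / real T"
    by (simp add: prob_\<tau> sum_divide_distrib)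
  finally show "(\<integral>\<omega>. ?q (\<tau> \<omega>) \<omega> \<partial>M) = (\<Sum>t<T. \<integral>\<omega>. ?q t \<omega> \<partial>M) / real T" .
qed

end

theorem corollary3:
  fixes E :: "('n::finite \<times> 'n) set"
    and W :: "real^'n^'n"
    and U :: "real^'m^'n"
    and B :: "'n \<Rightarrow> 'z measure"
    and loss :: "'n \<Rightarrow> real^'d \<Rightarrow> 'z \<Rightarrow> real"
    and f_loc :: "'n \<Rightarrow> real^'d \<Rightarrow> real"
    and f :: "real^'d \<Rightarrow> real"
    and \<theta>0 :: "'n \<Rightarrow> real^'d"
    and M :: "'w measure"
    and Z :: "nat \<Rightarrow> 'n \<Rightarrow> 'w \<Rightarrow> 'z"
    and \<tau> :: "nat \<Rightarrow> 'w \<Rightarrow> nat"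
    and \<theta> :: "nat \<Rightarrow> nat \<Rightarrow> 'n \<Rightarrow> 'w \<Rightarrow> real^'d"
    and \<gamma> :: "nat \<Rightarrow> nat \<Rightarrow> real"
    and L \<sigma> \<sigma>_bar \<zeta> \<zeta>_H L_H \<rho> D n :: real
  assumes n_def: "n = real CARD('n)"
    and constants: "0 \<le> L" "0 \<le> \<zeta>" "0 \<le> \<sigma>" "0 \<le> \<sigma>_bar" "0 \<le> \<zeta>_H" "0 \<le> L_H" "0 < \<rho>" "\<rho> \<le> 1"
    and step_defined: "L * \<sigma>\<^sup>2 \<noteq> 0"
    and graph: "refl E" "sym E" "E\<^sup>* = UNIV"
    and weights: "weighted_adjacency E W"
    and prob_B: "\<And>i. prob_space (B i)"
    and loss_differentiable: "\<And>i \<theta> z. z \<in> space (B i) \<Longrightarrow> (\<lambda>\<theta>. loss i \<theta> z) differentiable (at \<theta>)"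
    and loss_integrable: "\<And>i \<theta>. integrable (B i) (loss i \<theta>)"
    and f_loc_def: "\<And>i \<theta>. f_loc i \<theta> = (\<integral>z. loss i \<theta> z \<partial>B i)"
    and f_loc_C2: "\<And>i. twice_continuously_differentiable (f_loc i)"
    and f_def: "\<And>\<theta>. f \<theta> = avg (\<lambda>i. f_loc i \<theta>)"
    and f_bounded: "bdd_below (range f)"
    and smooth: "\<And>i \<theta> \<theta>'. norm (gradient (f_loc i) \<theta>' - gradient (f_loc i) \<theta>) \<le> L * norm (\<theta>' - \<theta>)"
    and heterogeneity: "\<And>i \<theta>. norm (gradient f \<theta> - gradient (f_loc i) \<theta>) \<le> \<zeta>"
    and W_stochastic: "doubly_stochastic W"
    and U_projection: "mat 1 - (\<chi> i j. 1 / n) = U ** transpose U"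
    and spectral_gap: "spectral_norm (transpose U ** W ** U) \<le> 1 - \<rho>"
    and unbiased: "\<And>i \<theta>. has_bochner_integral (B i)
          (\<lambda>z. gradient (\<lambda>\<theta>. loss i \<theta> z) \<theta>) (gradient (f_loc i) \<theta>)"
    and second_moment_integrable: "\<And>i \<theta>. integrable (B i)
          (\<lambda>z. norm (gradient (\<lambda>\<theta>. loss i \<theta> z) \<theta> - gradient (f_loc i) \<theta>) ^ 2)"
    and second_moment: "\<And>i \<theta>.
          (\<integral>z. norm (gradient (\<lambda>\<theta>. loss i \<theta> z) \<theta> - gradient (f_loc i) \<theta>) ^ 2 \<partial>B i) \<le> \<sigma> ^ 2"
    and fourth_moment_integrable: "\<And>i \<theta>. integrable (B i)
          (\<lambda>z. norm (gradient (\<lambda>\<theta>. loss i \<theta> z) \<theta> - gradient (f_loc i) \<theta>) ^ 4)"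
    and fourth_moment: "\<And>i \<theta>.
          (\<integral>z. norm (gradient (\<lambda>\<theta>. loss i \<theta> z) \<theta> - gradient (f_loc i) \<theta>) ^ 4 \<partial>B i) \<le> \<sigma>_bar ^ 4"
    and hessian_heterogeneity: "\<And>i \<theta>. spectral_norm (hessian f \<theta> - hessian (f_loc i) \<theta>) \<le> \<zeta>_H"
    and hessian_lipschitz: "\<And>i \<theta> \<theta>'.
          spectral_norm (hessian (f_loc i) \<theta>' - hessian (f_loc i) \<theta>) \<le> L_H * norm (\<theta>' - \<theta>)"
    and D_def: "D = f (avg \<theta>0) - (INF \<theta>. f \<theta>)"
    and step_size: "\<And>T t. \<gamma> T (Suc t) = 1 / sqrt (real T) * sqrt (2 * D * n / (L * \<sigma>\<^sup>2))"
    and prob_M: "prob_space M"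
    and samples: "independent_samples M B Z"
    and iterates: "\<And>T t i \<omega>. \<theta> T t i \<omega> = dsgd W (\<gamma> T) loss \<theta>0 (\<lambda>s j. Z s j \<omega>) t i"
    and random_index: "\<And>T. 1 \<le> T \<Longrightarrow> uniform_random_index M (sample_events M B Z) T (\<tau> T)"
  shows "\<exists>T0\<ge>1. \<forall>T\<ge>T0.
    integrable M (\<lambda>\<omega>. norm (gradient f (avg (\<lambda>i. \<theta> T (\<tau> T \<omega>) i \<omega>))) ^ 2) \<and>
    (\<integral>\<omega>. norm (gradient f (avg (\<lambda>i. \<theta> T (\<tau> T \<omega>) i \<omega>))) ^ 2 \<partial>M)
      \<le> sqrt (32 * D * L * \<sigma>\<^sup>2 / (n * real T))
        + 432 * L_H\<^sup>2 * (\<sigma>_bar ^ 4 + 4 * \<zeta> ^ 4) / (\<rho> ^ 4 * (real T)\<^sup>2) * ((2 * D * n)\<^sup>2 / (L * \<sigma>\<^sup>2)\<^sup>2)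
        + 64 * \<zeta>_H\<^sup>2 * (\<sigma>\<^sup>2 + \<zeta>\<^sup>2) / (\<rho>\<^sup>2 * real T) * (2 * D * n / (L * \<sigma>\<^sup>2))"
proof -
  let ?F = "\<lambda>i. gradient (f_loc i)" and ?fs = "INF \<theta>. f \<theta>"
  have n: "0 < n" and L: "0 < L" and \<sigma>: "0 < \<sigma>\<^sup>2"
    using n_def constants step_defined by (auto simp: less_le)
  have f_eq: "f = (\<lambda>\<theta>. avg (\<lambda>i. f_loc i \<theta>))" using f_def by auto
  have f_loc_diff: "f_loc i differentiable (at x)" for i x
    using f_loc_C2[of i] by (simp add: twice_continuously_differentiable_def)
  then have gderiv_f: "GDERIV f x :> avg (\<lambda>i. ?F i x)" for x
    unfolding f_eq by (rule gderiv_avg)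
  then have f_diff: "f differentiable (at x)" and grad_f: "gradient f x = avg (\<lambda>i. ?F i x)" for x
    by (auto simp: gderiv_def differentiable_def intro!: gradient_eqI)
  have fs: "?fs \<le> f x" for x by (rule cINF_lower[OF f_bounded]) simp
  have D: "0 \<le> D" using fs by (simp add: D_def)
  \<comment> \<open>Chosen so that c^2 = b / T and L b \<sigma>^2 / n = 2 D.\<close>
  define b where "b = 2 * D * n / (L * \<sigma>\<^sup>2)"
  define c where "c T = 1 / sqrt (real T) * sqrt b" for T
  have b: "0 \<le> b" using D n L \<sigma> by (simp add: b_def)
  have c_nonneg: "0 \<le> c T" for T using b by (simp add: c_def)
  have c_sq: "(c T)\<^sup>2 = b / real T" for T
    using b by (simp add: c_def power_mult_distrib power_divide)
  define V where "V = (\<Sum>i\<in>UNIV. (norm (\<theta>0 i - avg \<theta>0))\<^sup>2)"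
  define K where "K = 3 * (1 + 1 / \<rho>) * (n * (\<sigma>\<^sup>2 + \<zeta>\<^sup>2))"
  \<comment> \<open>Bounds the summed expected consensus error for every horizon, since T c^2 =
    b.\<close>
  define R where "R = 2 / \<rho> * (V + b * K)"
  \<comment> \<open>The three entries encode L c \<le> 1, the second condition in
    \<open>c_small\<close>, and c L^2 R / n \<le> 4 D, each solved for T. For D = 0 the last
    quotient is 0 by the convention for division by zero.\<close>
  obtain T0 :: nat where T0:
      "max (L\<^sup>2 * b) (max (6 * (1 + 1 / \<rho>) * b * L\<^sup>2 / \<rho>) ((L\<^sup>2 * R * sqrt b / (4 * D * n))\<^sup>2)) \<le> real T0"
    using real_arch_simple by blast
  have main: "integrable M (\<lambda>\<omega>. norm (gradient f (avg (\<lambda>i. \<theta> T (\<tau> T \<omega>) i \<omega>))) ^ 2) \<and>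
      (\<integral>\<omega>. norm (gradient f (avg (\<lambda>i. \<theta> T (\<tau> T \<omega>) i \<omega>))) ^ 2 \<partial>M)
        \<le> sqrt (32 * D * L * \<sigma>\<^sup>2 / (n * real T))" if T: "Suc T0 \<le> T" for T
  proof -
    have T_pos: "0 < real T" and T_le: "real T0 \<le> real T" using T by auto
    have T_large: "L\<^sup>2 * b \<le> real T" "6 * (1 + 1 / \<rho>) * b * L\<^sup>2 / \<rho> \<le> real T"
        "(L\<^sup>2 * R * sqrt b / (4 * D * n))\<^sup>2 \<le> real T"
      using T0 T_le by auto
    interpret P: dsgd_objective M W "\<gamma> T" "c T" loss \<theta>0 B Z ?F \<sigma> L U f \<zeta> \<rho>
    proof (intro dsgd_objective.intro dsgd_process.intro)
      show "dsgd_process_axioms M (\<gamma> T) (c T) loss B Z ?F \<sigma> L"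
      proof (rule dsgd_process_axioms.intro)
        show "\<gamma> T (Suc t) = c T" for t by (simp add: step_size c_def b_def)
      qed (fact prob_B loss_differentiable borel_measurable_integrable[OF loss_integrable] samples
          unbiased second_moment_integrable second_moment smooth)+
      have "(L * c T)\<^sup>2 \<le> 1\<^sup>2"
        using T_large(1) T_pos by (simp add: power_mult_distrib c_sq)
      then have Lc: "L * c T \<le> 1" by (rule power2_le_imp_le) simp
      have Lc2: "3 * (1 + 1 / \<rho>) * (c T)\<^sup>2 * L\<^sup>2 \<le> \<rho> / 2"
        using T_large(2) T_pos constants(7) by (simp add: c_sq field_simps)
      show "dsgd_objective_axioms W (c T) ?F L U f \<zeta> \<rho>"
        by (intro dsgd_objective_axioms.intro)
          (fact W_stochastic U_projection[unfolded n_def] spectral_gap constants c_nonneg Lc Lc2 f_diff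
            grad_f heterogeneity)+
    qed (rule prob_M)
    have Xbar: "avg (\<lambda>i. \<theta> T t i \<omega>) = P.Xbar t \<omega>" for t \<omega>
      by (simp add: iterates P.Xbar_def P.X_def)
    show ?thesis
    \<comment> \<open>The case is separated because \<open>q\<close> below would vanish and could
      not be divided by.\<close>
    proof (cases "D = 0")
      case True
      then have "c T = 0" by (simp add: c_def b_def)
      then have "P.Xbar t \<omega> = avg \<theta>0" for t \<omega>
        by (induction t) (simp_all add: P.Xbar_Suc, simp add: P.Xbar_def P.X_def)
      moreover have "gradient f (avg \<theta>0) = 0"
        by (rule gradient_at_minimum[OF f_diff]) (use True fs in \<open>simp add: D_def\<close>)
      ultimately show ?thesis by (simp add: Xbar True)
    next
      case False
      with D have D: "0 < D" by simp
      then have b: "0 < b" using n L \<sigma> by (simp add: b_def)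
      have \<tau>: "uniform_random_index M (sample_events M B Z) T (\<tau> T)" and T1: "1 \<le> T"
        using random_index T by auto
      note \<tau>_exp = P.random_index_expectation[OF \<tau> T1]
      define Q where "Q = (\<integral>\<omega>. (norm (gradient f (P.Xbar (\<tau> T \<omega>) \<omega>)))\<^sup>2 \<partial>M)"
      \<comment> \<open>This is c T: multiplying the time average by it gives c times the sum, the
        quantity bounded by \<open>gradient_sum\<close>.\<close>
      define q where "q = sqrt (b * real T)"
      have q: "0 < q" and cT: "c T * real T = q" and c_eq: "c T = b / q"
        using b T_pos by (auto simp: q_def c_def real_sqrt_mult real_div_sqrt field_simps)
      have K: "P.K = K" by (simp add: P.K_def K_def n_def)
      have "q * Q = c T * (\<Sum>t<T. \<integral>\<omega>. (norm (gradient f (P.Xbar t \<omega>)))\<^sup>2 \<partial>M)"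
        using T_pos by (simp add: Q_def \<tau>_exp flip: cT)
      also have "\<dots> \<le> 2 * D + real T * (L * (c T)\<^sup>2 * \<sigma>\<^sup>2 / n)
          + c T * L\<^sup>2 / n * (2 / \<rho> * (V + real T * ((c T)\<^sup>2 * K)))"
        using P.gradient_sum[OF fs, of T] by (simp add: K V_def D_def flip: n_def)
      also have "\<dots> = 2 * D + L * b * \<sigma>\<^sup>2 / n + c T * L\<^sup>2 / n * R"
        using T_pos by (simp add: c_sq R_def)
      also have "L * b * \<sigma>\<^sup>2 / n = 2 * D" using n L \<sigma> by (simp add: b_def)
      also have "c T * L\<^sup>2 / n * R \<le> 4 * D"
      proof -
        have "L\<^sup>2 * R * sqrt b / (4 * D * n) \<le> sqrt (real T)"
          by (rule real_le_rsqrt[OF T_large(3)])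
        then show ?thesis using D n T_pos by (simp add: c_def field_simps)
      qed
      \<comment> \<open>The budget is 2 D from the initial gap, 2 D from the noise and 4 D from the
        consensus error.\<close>
      finally have "q * Q \<le> 8 * D" by simp
      then have "Q \<le> 8 * D / q" using q by (simp add: field_simps)
      also have "\<dots> = sqrt ((8 * D / q)\<^sup>2)" using D q by simp
      also have "(8 * D / q)\<^sup>2 = 32 * D * L * \<sigma>\<^sup>2 / (n * real T)"
      proof -
        have "q\<^sup>2 = 2 * D * n / (L * \<sigma>\<^sup>2) * real T" using b T_pos by (simp add: q_def b_def[symmetric])
        then show ?thesis using D n L \<sigma> T_pos
          by (simp add: power_divide power_mult_distrib) (simp add: field_simps power2_eq_square)
      qed
      finally show ?thesis using \<tau>_exp(1) by (simp add: Xbar Q_def)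
    qed
  qed
  have rest: "0 \<le> 432 * L_H\<^sup>2 * (\<sigma>_bar ^ 4 + 4 * \<zeta> ^ 4) / (\<rho> ^ 4 * (real T)\<^sup>2) * ((2 * D * n)\<^sup>2 / (L * \<sigma>\<^sup>2)\<^sup>2)"
      "0 \<le> 64 * \<zeta>_H\<^sup>2 * (\<sigma>\<^sup>2 + \<zeta>\<^sup>2) / (\<rho>\<^sup>2 * real T) * (2 * D * n / (L * \<sigma>\<^sup>2))" for T
    using constants D n by (auto intro!: mult_nonneg_nonneg divide_nonneg_nonneg add_nonneg_nonneg)
  show ?thesis (is "\<exists>T0\<ge>1. \<forall>T\<ge>T0. ?I T \<and> ?E T \<le> ?R1 T + ?R2 T + ?R3 T")
  proof (rule exI[of _ "Suc T0"], intro conjI[OF _ allI[OF impI]])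
    fix T assume "Suc T0 \<le> T"
    note bound = main[OF this]
    show "?I T \<and> ?E T \<le> ?R1 T + ?R2 T + ?R3 T"
      using bound by (intro conjI add_increasing2 rest) blast+
  qed simp
qed

end
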